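(* Let $\mathcal{O}=\{t_1,\dots,t_\mu\}$ be an order ideal in $\mathbb{T}^n$. Let $\mathcal{A}_1,\dots,\mathcal{A}_n\in\mathrm{Mat}_\mu(K[C])$ be the generic multiplication matrices for $\mathcal{O}$, and let $I(\mathbb{B}_{\mathcal{O}})\subseteq K[C]$ be the ideal generated by the entries of the commutators $\mathcal{A}_r\mathcal{A}_s-\mathcal{A}_s\mathcal{A}_r$ for $1\le r<s\le n$. Let $z_1,\dots,z_\mu$ be new indeterminates, and let $D\in\mathrm{Mat}_\mu(K[C][z_1,\dots,z_\mu])$ be the matrix whose $i$-th column is $$t_i(\mathcal{A}_1^{\mathrm{tr}},\dots,\mathcal{A}_n^{\mathrm{tr}})\cdot(z_1,\dots,z_\mu)^{\mathrm{tr}}\qquad(i=1,\dots,\mu).$$ Let $J$ be the ideal of $K[C]$ generated by the coefficients of $\det(D)$ with respect to the indeterminates $z_1,\dots,z_\mu$. Then the ideal $I(\mathbb{B}_{\mathcal{O}})+J$ defines a closed subscheme $\mathrm{NonLGor}_{\mathcal{O}}$ of $\mathbb{B}_{\mathcal{O}}$ such that the set of $K$-rational points of the complement $\mathbb{B}_{\mathcal{O}}\setminus\mathrm{NonLGor}_{\mathcal{O}}$ is precisely the set of locally Gorenstein points of $\mathbb{B}_{\mathcal{O}}$.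
   Context: $K$ is an arbitrary field, $P=K[x_1,\dots,x_n]$, and $\mathbb{T}^n$ is the monoid of terms (power products) in $x_1,\dots,x_n$. An order ideal is a finite set $\mathcal{O}=\{t_1,\dots,t_\mu\}\subset\mathbb{T}^n$ with $\mu\ge 1$ containing every divisor in $\mathbb{T}^n$ of each of its elements; it is always ordered so that $\deg(t_1)\le\cdots\le\deg(t_\mu)$, hence $t_1=1$. Its border is $\partial\mathcal{O}=(x_1\mathcal{O}\cup\cdots\cup x_n\mathcal{O})\setminus\mathcal{O}=\{b_1,\dots,b_\nu\}$. Let $C=\{c_{ij}\mid 1\le i\le\mu,\ 1\le j\le\nu\}$ be new indeterminates. The $r$-th generic multiplication matrix $\mathcal{A}_r=(a^{(r)}_{ij})\in\mathrm{Mat}_\mu(K[C])$ has $a^{(r)}_{ij}=\delta_{im}$ if $x_rt_j=t_m$ and $a^{(r)}_{ij}=c_{im}$ if $x_rt_j=b_m$. The border basis scheme $\mathbb{B}_{\mathcal{O}}\subseteq\mathrm{Spec}(K[C])$ is the closed subscheme defined by $I(\mathbb{B}_{\mathcal{O}})$. For a $K$-rational point $\Gamma=(\gamma_{ij})$ of $\mathbb{B}_{\mathcal{O}}$, let $I_\Gamma\subset P$ be the ideal generated by $b_j-\sum_i\gamma_{ij}t_i$ ($j=1,\dots,\nu$); $\Gamma$ represents the 0-dimensional scheme $\mathbb{X}_\Gamma\subset\mathbb{A}^n_K$ with vanishing ideal $I_\Gamma$, and the residue classes of $\mathcal{O}$ form a $K$-basis of $P/I_\Gamma$. For a 0-dimensional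 subscheme $\mathbb{X}\subset\mathbb{A}^n_K$ with vanishing ideal $I_{\mathbb{X}}$ put $R_{\mathbb{X}}=P/I_{\mathbb{X}}$. $\mathbb{X}$ is locally Gorenstein if, for the primary decomposition $I_{\mathbb{X}}=\mathfrak{Q}_1\cap\cdots\cap\mathfrak{Q}_s$, every local ring $P/\mathfrak{Q}_i$ is Gorenstein (i.e. its socle, the annihilator of the maximal ideal, is 1-dimensional over the residue field). A locally Gorenstein point of $\mathbb{B}_{\mathcal{O}}$ is a $K$-rational point $\Gamma$ such that $\mathbb{X}_\Gamma$ is locally Gorenstein. For a term $t=x_1^{\alpha_1}\cdots x_n^{\alpha_n}$ and matrices $M_1,\dots,M_n$, $t(M_1,\dots,M_n)=M_1^{\alpha_1}\cdots M_n^{\alpha_n}$. Conventions: statements about $K$-rational points may be read for $L$-rational points for any field extension $L\supseteq K$; an ideal is said to define a subscheme up to radical. *)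

theory Defs
  imports
    "HOL-Analysis.Analysis"
    "HOL-Library.Poly_Mapping"
    "HOL-Algebra.Algebraic_Closure_Type"
begin

section \<open>Polynomial rings\<close>

text \<open>
  The indeterminates of a polynomial ring are the elements of a type.  The monoid of terms is
  written additively: the term with exponent vector \<open>s\<close> is \<open>s\<close> itself, the term \<open>1\<close> is \<open>0\<close>, and
  \<open>s + u\<close> is the product of the terms \<open>s\<close> and \<open>u\<close>.
\<close>

type_synonym 'x pterm = "'x \<Rightarrow>\<^sub>0 nat"
type_synonym ('x, 'a) mpoly = "'x pterm \<Rightarrow>\<^sub>0 'a"

definition pvar :: "'x \<Rightarrow> 'x pterm" where
  "pvar x = Poly_Mapping.single x 1"

definition pterm_deg :: "'x pterm \<Rightarrow> nat" where
  "pterm_deg s = (\<Sum>x\<in>Poly_Mapping.keys s. Poly_Mapping.lookup s x)"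

definition mconst :: "'a::zero \<Rightarrow> ('x, 'a) mpoly" where
  "mconst a = Poly_Mapping.single 0 a"

definition mmonom :: "'x pterm \<Rightarrow> ('x, 'a::zero_neq_one) mpoly" where
  "mmonom s = Poly_Mapping.single s 1"

definition mvar :: "'x \<Rightarrow> ('x, 'a::zero_neq_one) mpoly" where
  "mvar x = mmonom (pvar x)"

definition meval :: "('a::zero \<Rightarrow> 'b::comm_ring_1) \<Rightarrow> ('x \<Rightarrow> 'b) \<Rightarrow> ('x, 'a) mpoly \<Rightarrow> 'b" where
  "meval \<phi> \<Gamma> f = (\<Sum>s\<in>Poly_Mapping.keys f. \<phi> (Poly_Mapping.lookup f s) *
     (\<Prod>x\<in>Poly_Mapping.keys s. \<Gamma> x ^ Poly_Mapping.lookup s x))"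

section \<open>Locally Gorenstein ideals\<close>

definition ideal_radical :: "('a, 'b) ring_scheme \<Rightarrow> 'a set \<Rightarrow> 'a set" where
  "ideal_radical R I = {a \<in> carrier R. \<exists>k::nat. a [^]\<^bsub>R\<^esub> k \<in> I}"

definition primary_ideal :: "('a, 'b) ring_scheme \<Rightarrow> 'a set \<Rightarrow> bool" where
  "primary_ideal R Q \<longleftrightarrow> ideal Q R \<and> Q \<noteq> carrier R \<and>
     (\<forall>a\<in>carrier R. \<forall>b\<in>carrier R. a \<otimes>\<^bsub>R\<^esub> b \<in> Q \<longrightarrow> a \<in> Q \<or> b \<in> ideal_radical R Q)"

definition primary_decomposition :: "('a, 'b) ring_scheme \<Rightarrow> 'a set \<Rightarrow> 'a set set \<Rightarrow> bool" where
  "primary_decomposition R I Qs \<longleftrightarrow>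
     finite Qs \<and> (\<forall>Q\<in>Qs. primary_ideal R Q) \<and> I = carrier R \<inter> \<Inter>Qs \<and>
     (\<forall>Q\<in>Qs. I \<noteq> carrier R \<inter> \<Inter>(Qs - {Q})) \<and> inj_on (ideal_radical R) Qs"

definition socle :: "('a, 'b) ring_scheme \<Rightarrow> 'a set \<Rightarrow> 'a set" where
  "socle R \<mm> = {a \<in> carrier R. \<forall>x\<in>\<mm>. x \<otimes>\<^bsub>R\<^esub> a = \<zero>\<^bsub>R\<^esub>}"

text \<open>
  The residue field \<open>R Quot \<mm>\<close> acts on the socle: all representatives \<open>r\<close> of a class \<open>c\<close> have
  the same product with a socle element.
\<close>

definition residue_smult :: "('a, 'b) ring_scheme \<Rightarrow> 'a set \<Rightarrow> 'a \<Rightarrow> 'a" where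
  "residue_smult R c a = (THE y. \<forall>r\<in>c. r \<otimes>\<^bsub>R\<^esub> a = y)"

text \<open>
  The last conjunct says that the socle has a one-element basis over the residue field.  This
  socle condition is the Gorenstein property for artinian local rings, which is the only case
  in which it is used.
\<close>

definition gorenstein_local_ring :: "('a, 'b) ring_scheme \<Rightarrow> bool" where
  "gorenstein_local_ring R \<longleftrightarrow> cring R \<and>
     (\<exists>\<mm>. maximalideal \<mm> R \<and> (\<forall>\<mm>'. maximalideal \<mm>' R \<longrightarrow> \<mm>' = \<mm>) \<and>
       (\<exists>s\<in>socle R \<mm>. \<forall>a\<in>socle R \<mm>. \<exists>!c. c \<in> carrier (R Quot \<mm>) \<and> a = residue_smult R c s))"

text \<open>
  For a 0-dimensional ideal of a polynomial ring over a field the irredundant primary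
  decomposition exists and is unique, since all associated primes are maximal.
\<close>

definition locally_gorenstein :: "('a, 'b) ring_scheme \<Rightarrow> 'a set \<Rightarrow> bool" where
  "locally_gorenstein R I \<longleftrightarrow>
     (\<exists>Qs. primary_decomposition R I Qs \<and> (\<forall>Q\<in>Qs. gorenstein_local_ring (R Quot Q)))"

section \<open>Order ideals and border basis schemes\<close>

definition order_ideal :: "'n pterm set \<Rightarrow> bool" where
  "order_ideal \<O> \<longleftrightarrow> finite \<O> \<and> \<O> \<noteq> {} \<and> (\<forall>s u. s + u \<in> \<O> \<longrightarrow> s \<in> \<O>)"

definition border :: "'n pterm set \<Rightarrow> 'n pterm set" where
  "border \<O> = {pvar r + s | r s. s \<in> \<O>} - \<O>"

text \<open>
  In the following, \<open>t\<close> enumerates an order ideal and \<open>b\<close> enumerates its border, both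
  injectively; the indeterminate \<open>c\<^sub>i\<^sub>j\<close> of \<open>K[C]\<close> is the pair \<open>(i, j)\<close>.
\<close>

definition generic_mult_matrix ::
  "('m::finite \<Rightarrow> 'n pterm) \<Rightarrow> ('v \<Rightarrow> 'n pterm) \<Rightarrow> 'n
     \<Rightarrow> ('m \<times> 'v, 'k::field) mpoly ^ 'm ^ 'm" where
  "generic_mult_matrix t b r = (\<chi> i j.
     if pvar r + t j \<in> range t
     then (if i = inv_into UNIV t (pvar r + t j) then 1 else 0)
     else mvar (i, inv_into UNIV b (pvar r + t j)))"

definition border_basis_ideal ::
  "('m::finite \<Rightarrow> 'n::linorder pterm) \<Rightarrow> ('v \<Rightarrow> 'n pterm)
     \<Rightarrow> ('m \<times> 'v, 'k::field) mpoly set" where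
  "border_basis_ideal t b = Idl\<^bsub>ring_of_type_algebra\<^esub>
     {(generic_mult_matrix t b r ** generic_mult_matrix t b s
       - generic_mult_matrix t b s ** generic_mult_matrix t b r) $ i $ j | r s i j. r < s}"

definition matrix_power :: "'a::semiring_1 ^ 'm ^ 'm \<Rightarrow> nat \<Rightarrow> 'a ^ 'm ^ 'm::finite" where
  "matrix_power M k = (((**) M) ^^ k) (mat 1)"

text \<open>
  The product \<open>M\<^sub>1\<^bsup>\<alpha>\<^sub>1\<^esup> ** \<dots> ** M\<^sub>n\<^bsup>\<alpha>\<^sub>n\<^esup>\<close> in the order of the
  indeterminates; the generic multiplication matrices do not commute.
\<close>

definition pterm_matrix_eval ::
  "('n::{finite,linorder} \<Rightarrow> 'a::semiring_1 ^ 'm ^ 'm) \<Rightarrow> 'n pterm \<Rightarrow> 'a ^ 'm ^ 'm::finite" where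
  "pterm_matrix_eval M s =
     foldr (\<lambda>x N. matrix_power (M x) (Poly_Mapping.lookup s x) ** N)
       (sorted_list_of_set UNIV) (mat 1)"

definition gorenstein_matrix ::
  "('m::finite \<Rightarrow> 'n::{finite,linorder} pterm) \<Rightarrow> ('v \<Rightarrow> 'n pterm)
     \<Rightarrow> ('m, ('m \<times> 'v, 'k::field) mpoly) mpoly ^ 'm ^ 'm" where
  "gorenstein_matrix t b = (\<chi> k i.
     ((\<chi> p q. mconst (pterm_matrix_eval (\<lambda>r. transpose (generic_mult_matrix t b r)) (t i) $ p $ q))
       *v (\<chi> q. mvar q)) $ k)"

definition gorenstein_det_ideal ::
  "('m::finite \<Rightarrow> 'n::{finite,linorder} pterm) \<Rightarrow> ('v \<Rightarrow> 'n pterm)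
     \<Rightarrow> ('m \<times> 'v, 'k::field) mpoly set" where
  "gorenstein_det_ideal t b = Idl\<^bsub>ring_of_type_algebra\<^esub>
     (range (Poly_Mapping.lookup (det (gorenstein_matrix t b))))"

definition nonLGor_ideal ::
  "('m::finite \<Rightarrow> 'n::{finite,linorder} pterm) \<Rightarrow> ('v \<Rightarrow> 'n pterm)
     \<Rightarrow> ('m \<times> 'v, 'k::field) mpoly set" where
  "nonLGor_ideal t b =
     border_basis_ideal t b <+>\<^bsub>ring_of_type_algebra\<^esub> gorenstein_det_ideal t b"

section \<open>Rational points\<close>

definition zero_locus :: "'a::comm_ring_1 set \<Rightarrow> 'a set set" where
  "zero_locus I = {p. primeideal p ring_of_type_algebra \<and> I \<subseteq> p}"

text \<open>
  For a field extension \<open>\<phi>\<close> from \<open>K\<close> to \<open>L\<close>, an \<open>L\<close>-rational point of the affine space with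
  coordinate ring \<open>K[x | x :: 'x]\<close> is given by its coordinates \<open>\<Gamma>\<close>.  Its underlying point in
  the spectrum is the kernel of the evaluation at \<open>\<Gamma>\<close>, and it is a point of the locally closed
  subscheme with underlying set \<open>U\<close> if this kernel belongs to \<open>U\<close>.
\<close>

definition rational_points ::
  "('k::field \<Rightarrow> 'l::field) \<Rightarrow> ('x, 'k) mpoly set set \<Rightarrow> ('x \<Rightarrow> 'l) set" where
  "rational_points \<phi> U = {\<Gamma>. {f. meval \<phi> \<Gamma> f = 0} \<in> U}"

definition point_ideal ::
  "('m::finite \<Rightarrow> 'n pterm) \<Rightarrow> ('v \<Rightarrow> 'n pterm) \<Rightarrow> ('m \<times> 'v \<Rightarrow> 'l::field)
     \<Rightarrow> ('n, 'l) mpoly set" where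
  "point_ideal t b \<Gamma> = Idl\<^bsub>ring_of_type_algebra\<^esub>
     (range (\<lambda>j. mmonom (b j) - (\<Sum>i\<in>UNIV. mconst (\<Gamma> (i, j)) * mmonom (t i))))"

definition locally_gorenstein_points ::
  "('m::finite \<Rightarrow> 'n::linorder pterm) \<Rightarrow> ('v \<Rightarrow> 'n pterm) \<Rightarrow> ('k::field \<Rightarrow> 'l::field)
     \<Rightarrow> ('m \<times> 'v \<Rightarrow> 'l) set" where
  "locally_gorenstein_points t b \<phi> =
     {\<Gamma> \<in> rational_points \<phi> (zero_locus (border_basis_ideal t b)).
        locally_gorenstein ring_of_type_algebra (point_ideal t b \<Gamma>)}"

end

theory Submission
  imports Defs
begin

text \<open>
  Let \<open>\<Gamma>\<close> be a point with values in a field \<open>L\<close> at which the generic multiplication matrices commute.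
  The commuting matrices \<open>A\<^sub>r = A\<^sub>r(\<Gamma>)\<close> turn \<open>L\<^sup>\<mu>\<close> into a module over the polynomial ring \<open>P\<close>.
  Since the order ideal contains all divisors of its elements, \<open>t\<^sub>j\<close> maps the basis vector of the term
  \<open>1\<close> to the \<open>j\<close>-th basis vector; hence the module is cyclic, the annihilator of its generator
  is \<open>I\<^sub>\<Gamma>\<close>, and \<open>L\<^sup>\<mu>\<close> is a model of \<open>P/I\<^sub>\<Gamma>\<close> (lemma \<open>point_ideal_eq_I\<close>).  In this model the
  entry \<open>(k, i)\<close> of \<open>D\<close>, specialised at \<open>\<Gamma>\<close>, is \<open>\<lambda>\<^sub>z(t\<^sub>i t\<^sub>k)\<close>, where \<open>\<lambda>\<^sub>z\<close> is the linear form with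
  coordinates \<open>z\<close>.  So \<open>D\<close> is the Gram matrix of the bilinear form \<open>(f, g) \<mapsto> \<lambda>\<^sub>z(f g)\<close> for the generic
  linear form, and the claim is that this form is nondegenerate over \<open>L[z]\<close> iff \<open>P/I\<^sub>\<Gamma>\<close> is locally
  Gorenstein.

  The bridge is the property \<open>cyclic_socles\<close>: for every maximal ideal \<open>M\<close>, the elements of
  \<open>P/I\<close> that are killed by \<open>M\<close> form a vector space of dimension at most 1 over \<open>P/M\<close>.  It is
  equivalent to being locally Gorenstein because a primary component of \<open>I\<close> whose radical is \<open>M\<close>
  has the same \<open>M\<close>-socle as \<open>I\<close> (lemmas \<open>locally_gorenstein_imp_cyclic_socles\<close> and
  \<open>cyclic_socles_imp_locally_gorenstein\<close>).

  If all socles are cyclic, choose a generator of each.  They are linearly independent, so some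
  linear form over \<open>L\<close> has the value 1 on all of them.  Every nonzero ideal of \<open>P/I\<close> contains one of
  the generators, so the form vanishes on no nonzero ideal, that is, its Gram matrix is invertible
  (lemma \<open>cyclic_socles_imp_nondegenerate\<close>).  The linear form has coordinates in \<open>L\<close> itself,
  so this also works over a finite field.

  If some \<open>M\<close>-socle contains two elements \<open>a\<close>, \<open>b\<close> that are independent over \<open>P/M\<close>, a field of degree
  \<open>d\<close> over \<open>L\<close>, then \<open>S = (a, b)\<close> has dimension \<open>2 d\<close>, \<open>N = M/I\<close> has dimension \<open>\<mu> - d\<close>, and the product
  of \<open>N\<close> and \<open>S\<close> is 0.  In bases adapted to \<open>N\<close> and \<open>S\<close> every Gram matrix, the generic
  one included, has a block of zeros with \<open>\<mu> - d\<close> rows and \<open>2 d\<close> columns, so its determinant is 0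
  (lemma \<open>not_cyclic_socles_imp_det_0\<close>).
\<close>

unbundle no fps_syntax

section \<open>Ideals of a ring given by a type\<close>

lemma ring_of_type_algebra_simps [simp]:
  "carrier ring_of_type_algebra = UNIV"
  "mult ring_of_type_algebra x y = x * y"
  "add ring_of_type_algebra x y = x + y"
  "one ring_of_type_algebra = 1"
  "zero ring_of_type_algebra = 0"
  by (simp_all add: ring_of_type_algebra_def)

lemma nat_pow_ring_of_type_algebra [simp]:
  "a [^]\<^bsub>ring_of_type_algebra\<^esub> (k::nat) = (a::'p::comm_ring_1) ^ k"
proof -
  interpret cring "ring_of_type_algebra :: 'p ring" by (rule cring_from_type_algebra)
  show ?thesis by (induction k) (simp_all add: mult.commute)
qed

lemma a_inv_ring_of_type_algebra [simp]:
  "\<ominus>\<^bsub>ring_of_type_algebra\<^esub> a = - (a::'p::comm_ring_1)"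
proof -
  interpret cring "ring_of_type_algebra :: 'p ring" by (rule cring_from_type_algebra)
  show ?thesis
    by (rule minus_equality) simp_all
qed

lemma ideal_ring_of_type_algebra_iff:
  fixes J :: "'p::comm_ring_1 set"
  shows "ideal J ring_of_type_algebra \<longleftrightarrow>
    0 \<in> J \<and> (\<forall>a\<in>J. \<forall>b\<in>J. a + b \<in> J) \<and> (\<forall>a\<in>J. \<forall>x. x * a \<in> J)"  (is "?l \<longleftrightarrow> ?r")
proof
  assume ?l
  then interpret ideal J ring_of_type_algebra .
  note as = additive_subgroup.zero_closed[OF is_additive_subgroup]
    additive_subgroup.a_closed[OF is_additive_subgroup]
  show ?r using as I_l_closed by simp
next
  assume r: ?r
  have neg: "- a \<in> J" if "a \<in> J" for a
    using r that by (metis mult_minus1)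
  show ?l
  proof (rule idealI)
    show "ring (ring_of_type_algebra :: 'p ring)" by (rule ring_from_type_algebra)
    show "subgroup J (add_monoid ring_of_type_algebra)"
    proof
      fix a assume "a \<in> J"
      then show "inv\<^bsub>add_monoid ring_of_type_algebra\<^esub> a \<in> J"
        using neg unfolding a_inv_def[symmetric] by (simp only: a_inv_ring_of_type_algebra)
    qed (use r in auto)
  qed (use r in \<open>auto simp: mult.commute\<close>)
qed

lemma maximalideal_ring_of_type_algebra_iff:
  fixes M :: "'p::comm_ring_1 set"
  shows "maximalideal M ring_of_type_algebra \<longleftrightarrow>
    ideal M ring_of_type_algebra \<and> 1 \<notin> M \<and> (\<forall>x. x \<notin> M \<longrightarrow> (\<exists>y. 1 - x * y \<in> M))"  (is "?l \<longleftrightarrow> ?r")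
proof
  assume ?l
  then interpret maximalideal M ring_of_type_algebra .
  note id = is_ideal[unfolded ideal_ring_of_type_algebra_iff]
  have 1: "1 \<notin> M" using I_notcarr id by (metis UNIV_eq_I mult.right_neutral ring_of_type_algebra_simps(1))
  moreover have "\<exists>y. 1 - x * y \<in> M" if x: "x \<notin> M" for x
  proof -
    let ?J = "{m + x * y | m y. m \<in> M}"
    have "ideal ?J ring_of_type_algebra"
      unfolding ideal_ring_of_type_algebra_iff
    proof (intro conjI ballI allI)
      show "0 \<in> ?J" using id by (auto intro!: exI[of _ 0])
      fix a assume "a \<in> ?J" then obtain m y where a: "a = m + x * y" "m \<in> M" by auto
      show "z * a \<in> ?J" for z
        using a id by (intro CollectI exI[of _ "z*m"] exI[of _ "z*y"]) (auto simp: algebra_simps)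
      fix b assume "b \<in> ?J" then obtain m' y' where b: "b = m' + x * y'" "m' \<in> M" by auto
      show "a + b \<in> ?J"
        using a b id by (intro CollectI exI[of _ "m+m'"] exI[of _ "y+y'"]) (auto simp: algebra_simps)
    qed
    moreover have "M \<subseteq> ?J" by (intro subsetI CollectI) (metis add.right_neutral mult_zero_right)
    moreover have "x \<in> ?J" using id by (intro CollectI exI[of _ 0] exI[of _ 1]) auto
    ultimately have "?J = UNIV" using I_maximal[of ?J] x by auto
    then obtain m y where "1 = m + x * y" "m \<in> M" by blast
    then show ?thesis by (metis add_diff_cancel_right')
  qed
  ultimately show ?r using is_ideal by blast
next
  assume r: ?r
  show ?l
  proof (rule maximalidealI)
    show "ideal M ring_of_type_algebra" using r by blast
    show "carrier ring_of_type_algebra \<noteq> M" using r by auto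
    fix J assume J: "ideal J ring_of_type_algebra" "M \<subseteq> J"
    note id = J(1)[unfolded ideal_ring_of_type_algebra_iff]
    show "J = M \<or> J = carrier ring_of_type_algebra"
    proof (cases "J \<subseteq> M")
      case True then show ?thesis using J by auto
    next
      case False
      then obtain x y where x: "x \<in> J" "1 - x * y \<in> M" using r by blast
      then have "1 - x * y + y * x \<in> J" using id J(2) by blast
      then have "1 \<in> J" by (simp add: mult.commute)
      then show ?thesis using id by (metis UNIV_eq_I mult.right_neutral ring_of_type_algebra_simps(1))
    qed
  qed
qed

lemma maximalideal_prime_elem:
  fixes M :: "'p::comm_ring_1 set"
  assumes "maximalideal M ring_of_type_algebra" "a * b \<in> M" "a \<notin> M"
  shows "b \<in> M"
proof -
  interpret cring "ring_of_type_algebra :: 'p ring" by (rule cring_from_type_algebra)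
  from maximalideal_prime[OF assms(1)] interpret primeideal M ring_of_type_algebra .
  show ?thesis using I_prime[of a b] assms by auto
qed

lemma maximalideal_power_elem:
  fixes M :: "'p::comm_ring_1 set"
  assumes "maximalideal M ring_of_type_algebra" "a ^ k \<in> M"
  shows "a \<in> M"
  using assms(2)
proof (induction k)
  case 0
  then show ?case using assms(1) by (simp add: maximalideal_ring_of_type_algebra_iff)
next
  case (Suc k)
  then show ?case using maximalideal_prime_elem[OF assms(1), of a "a^k"] by auto
qed

section \<open>Gorenstein local rings and quotient rings\<close>

context cring begin

lemma residue_smult_socle:
  assumes m: "ideal \<mm> R" and s: "s \<in> socle R \<mm>" and x: "x \<in> carrier R"
  shows "residue_smult R (\<mm> +> x) s = x \<otimes> s"
proof -
  interpret ideal \<mm> R by fact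
  have "r \<otimes> s = x \<otimes> s" if "r \<in> \<mm> +> x" for r
  proof -
    obtain n where n: "n \<in> \<mm>" "r = n \<oplus> x" using \<open>r \<in> \<mm> +> x\<close> by (auto simp: a_r_coset_def')
    then have "n \<otimes> s = \<zero>" "n \<in> carrier R" "s \<in> carrier R"
      using s a_subset by (auto simp: socle_def)
    then show ?thesis using n x by (simp add: l_distr)
  qed
  then show ?thesis unfolding residue_smult_def
    using a_rcos_self[OF x] by (intro the_equality) (blast, metis)
qed

lemma annihilator_of_socle_element:
  assumes m: "maximalideal \<mm> R" and s: "s \<in> socle R \<mm>" "s \<noteq> \<zero>" and x: "x \<in> carrier R" "x \<otimes> s = \<zero>"
  shows "x \<in> \<mm>"
proof -
  interpret maximalideal \<mm> R by fact
  have sc: "s \<in> carrier R" and sm: "\<And>y. y \<in> \<mm> \<Longrightarrow> y \<otimes> s = \<zero>" using s by (auto simp: socle_def)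
  let ?A = "{y \<in> carrier R. y \<otimes> s = \<zero>}"
  have "ideal ?A R"
  proof (rule idealI)
    show "ring R" ..
    show "subgroup ?A (add_monoid R)"
    proof
      fix a assume "a \<in> ?A"
      then show "inv\<^bsub>add_monoid R\<^esub> a \<in> ?A"
        using sc unfolding a_inv_def[symmetric] by (simp add: l_minus)
    qed (use sc in \<open>auto simp: l_distr\<close>)
    show "x \<otimes> a \<in> ?A" if "a \<in> ?A" "x \<in> carrier R" for a x using that sc by (auto simp: m_assoc)
    show "a \<otimes> x \<in> ?A" if "a \<in> ?A" "x \<in> carrier R" for a x
      using that sc by (auto simp: m_comm[of a x] m_assoc)
  qed
  moreover have "\<mm> \<subseteq> ?A" using sm a_subset by auto
  moreover have "?A \<noteq> carrier R" using sc s(2) l_one by (metis (mono_tags, lifting) mem_Collect_eq one_closed)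
  ultimately have "?A = \<mm>" using I_maximal by blast
  then show ?thesis using x by auto
qed

text \<open>
  The coefficients from the residue field may be replaced by ring elements: two ring elements give
  the same multiple of a nonzero socle element \<open>s\<close> iff they are congruent modulo \<open>\<mm>\<close>, because the
  annihilator of \<open>s\<close> is exactly \<open>\<mm>\<close>.  Uniqueness of the coefficient is what excludes \<open>s = \<zero>\<close>.
\<close>

lemma socle_one_dimensional_iff:
  assumes m: "maximalideal \<mm> R" and s: "s \<in> socle R \<mm>"
  shows "(\<forall>a\<in>socle R \<mm>. \<exists>!c. c \<in> carrier (R Quot \<mm>) \<and> a = residue_smult R c s) \<longleftrightarrow>
    s \<noteq> \<zero> \<and> (\<forall>a\<in>socle R \<mm>. \<exists>x\<in>carrier R. a = x \<otimes> s)"  (is "?l \<longleftrightarrow> ?r")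
proof -
  interpret maximalideal \<mm> R by fact
  have id: "ideal \<mm> R" ..
  have sc: "s \<in> carrier R" using s by (auto simp: socle_def)
  have car: "c \<in> carrier (R Quot \<mm>) \<longleftrightarrow> (\<exists>x\<in>carrier R. c = \<mm> +> x)" for c
    unfolding FactRing_def A_RCOSETS_def' by simp
  note sm = residue_smult_socle[OF id s]
  show ?thesis
  proof
    assume l: ?l
    \<comment> \<open>For \<open>s = \<zero>\<close> the classes of \<open>\<zero>\<close> and \<open>\<one>\<close> would both be coefficients of \<open>\<zero>\<close>.\<close>
    have "s \<noteq> \<zero>"
    proof
      assume s0: "s = \<zero>"
      have "\<zero> \<in> socle R \<mm>" using s s0 by simp
      moreover have "\<zero> = residue_smult R (\<mm> +> \<zero>) s" "\<zero> = residue_smult R (\<mm> +> \<one>) s"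
        using sm[of \<zero>] sm[of \<one>] sc s0 by simp_all
      moreover have "\<mm> +> \<zero> \<in> carrier (R Quot \<mm>)" "\<mm> +> \<one> \<in> carrier (R Quot \<mm>)"
        using car zero_closed one_closed by blast+
      ultimately have "\<mm> +> \<zero> = \<mm> +> \<one>" using l by blast
      then have "\<one> \<in> \<mm>" using a_rcos_self[of \<one>] a_coset_add_zero[OF a_subset] by simp
      then show False using one_imp_carrier I_notcarr by blast
    qed
    moreover have "\<exists>x\<in>carrier R. a = x \<otimes> s" if as: "a \<in> socle R \<mm>" for a
    proof -
      obtain c where c: "c \<in> carrier (R Quot \<mm>)" "a = residue_smult R c s"
        using bspec[OF l as] by (elim ex1E conjE)
      then obtain x where x: "x \<in> carrier R" "c = \<mm> +> x" using car by blast
      show ?thesis by (rule bexI[OF _ x(1)]) (simp only: c(2) x(2) sm[OF x(1)])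
    qed
    ultimately show ?r by blast
  next
    assume r: ?r
    show ?l
    proof
      fix a assume a: "a \<in> socle R \<mm>"
      then obtain x where x: "x \<in> carrier R" "a = x \<otimes> s" using r by blast
      show "\<exists>!c. c \<in> carrier (R Quot \<mm>) \<and> a = residue_smult R c s"
      proof (rule ex1I[of _ "\<mm> +> x"])
        show "\<mm> +> x \<in> carrier (R Quot \<mm>) \<and> a = residue_smult R (\<mm> +> x) s"
          unfolding sm[OF x(1)] using x car by blast
        fix c assume c: "c \<in> carrier (R Quot \<mm>) \<and> a = residue_smult R c s"
        then obtain y where y: "y \<in> carrier R" "c = \<mm> +> y" using car by blast
        then have "y \<otimes> s = x \<otimes> s" using c x(2) by (simp only: sm[OF y(1)])
        then have "(y \<ominus> x) \<otimes> s = \<zero>" using x(1) y(1) sc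
          by (simp add: minus_eq l_distr l_minus r_neg)
        then have "y \<ominus> x \<in> \<mm>" using annihilator_of_socle_element[OF m s] r x y by simp
        then show "c = \<mm> +> x" using quotient_eq_iff_same_a_r_cos[OF id y(1) x(1)] y by simp
      qed
    qed
  qed
qed

end

lemma gorenstein_local_ring_iff:
  "gorenstein_local_ring R \<longleftrightarrow> cring R \<and>
     (\<exists>\<mm>. maximalideal \<mm> R \<and> (\<forall>\<mm>'. maximalideal \<mm>' R \<longrightarrow> \<mm>' = \<mm>) \<and>
       (\<exists>s\<in>socle R \<mm>. s \<noteq> \<zero>\<^bsub>R\<^esub> \<and> (\<forall>a\<in>socle R \<mm>. \<exists>x\<in>carrier R. a = x \<otimes>\<^bsub>R\<^esub> s)))"
proof (cases "cring R")
  case True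
  note * = cring.socle_one_dimensional_iff[OF True]
  show ?thesis unfolding gorenstein_local_ring_def
    by (intro arg_cong2[where f = conj] refl ex_cong1 conj_cong bex_cong *)
qed (simp add: gorenstein_local_ring_def)

lemma (in ring) maximalideal_Quot_iff:
  assumes Q: "ideal Q R"
  shows "maximalideal \<mm> (R Quot Q) \<longleftrightarrow> (\<exists>M. maximalideal M R \<and> Q \<subseteq> M \<and> \<mm> = (+>) Q ` M)"
proof -
  let ?F = "\<lambda>J. (+>) Q ` J"
  have bij: "bij_betw ?F {J. ideal J R \<and> Q \<subseteq> J} {J. ideal J (R Quot Q)}"
    by (rule quot_ideal_correspondence[OF Q])
  have F: "ideal (?F J) (R Quot Q)" "\<Union> (?F J) = J" if "ideal J R" "Q \<subseteq> J" for J
    using bij that ideal_incl_iff[OF Q that(1)] by (auto simp: bij_betw_def)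
  have G: "\<exists>J. ideal J R \<and> Q \<subseteq> J \<and> K = ?F J" if "ideal K (R Quot Q)" for K
    using bij that unfolding bij_betw_def by blast
  have Fc: "?F (carrier R) = carrier (R Quot Q)"
    unfolding FactRing_def A_RCOSETS_def' by auto
  have cR: "ideal (carrier R) R" "Q \<subseteq> carrier R"
    using oneideal Q by (auto dest: ideal.Icarr)
  show ?thesis
  proof
    assume "maximalideal \<mm> (R Quot Q)"
    then interpret m: maximalideal \<mm> "R Quot Q" .
    obtain M where M: "ideal M R" "Q \<subseteq> M" "\<mm> = ?F M" using G[OF m.is_ideal] by blast
    have "maximalideal M R"
    proof (rule maximalidealI)
      show "carrier R \<noteq> M" using m.I_notcarr Fc M(3) by auto
      fix J assume J: "ideal J R" "M \<subseteq> J" "J \<subseteq> carrier R"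
      then have "Q \<subseteq> J" using M by blast
      have "\<mm> \<subseteq> ?F J" "?F J \<subseteq> carrier (R Quot Q)"
        unfolding M(3) Fc[symmetric] using J by (auto intro: image_mono)
      then have "?F J = ?F M \<or> ?F J = ?F (carrier R)"
        using m.I_maximal[OF F(1)[OF J(1) \<open>Q \<subseteq> J\<close>]] unfolding M(3) Fc by simp
      then show "J = M \<or> J = carrier R"
        using F(2) J(1) \<open>Q \<subseteq> J\<close> M cR by metis
    qed (fact M)
    then show "\<exists>M. maximalideal M R \<and> Q \<subseteq> M \<and> \<mm> = ?F M" using M by blast
  next
    assume "\<exists>M. maximalideal M R \<and> Q \<subseteq> M \<and> \<mm> = ?F M"
    then obtain M where M: "maximalideal M R" "Q \<subseteq> M" "\<mm> = ?F M" by blast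
    interpret maximalideal M R by fact
    note F' = F[OF is_ideal M(2)]
    show "maximalideal \<mm> (R Quot Q)"
    proof (rule maximalidealI)
      show "ideal \<mm> (R Quot Q)" unfolding M(3) by (rule F'(1))
      show "carrier (R Quot Q) \<noteq> \<mm>" using F(2)[OF cR] Fc F'(2) M(3) I_notcarr by metis
      fix K assume K: "ideal K (R Quot Q)" "\<mm> \<subseteq> K" "K \<subseteq> carrier (R Quot Q)"
      obtain J where J: "ideal J R" "Q \<subseteq> J" "K = ?F J" using G[OF K(1)] by blast
      have "M \<subseteq> J" using F'(2) F(2)[OF J(1,2)] K(2) M(3) J(3) by (metis Union_mono)
      then have "J = M \<or> J = carrier R" using I_maximal J(1) by (meson ideal.Icarr subsetI)
      then show "K = \<mm> \<or> K = carrier (R Quot Q)" using J M Fc by auto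
    qed
  qed
qed

text \<open>
  Pulling everything back along \<open>R \<rightarrow> R/Q\<close> removes the cosets of the quotient ring, so that all later
  arguments compute with ring elements modulo ideals.
\<close>

lemma gorenstein_local_ring_Quot_iff:
  fixes Q :: "'p::comm_ring_1 set"
  assumes Q: "ideal Q ring_of_type_algebra"
  shows "gorenstein_local_ring (ring_of_type_algebra Quot Q) \<longleftrightarrow>
    (\<exists>M. maximalideal M ring_of_type_algebra \<and> Q \<subseteq> M \<and>
      (\<forall>M'. maximalideal M' ring_of_type_algebra \<and> Q \<subseteq> M' \<longrightarrow> M' = M) \<and>
      (\<exists>s. s \<notin> Q \<and> (\<forall>m\<in>M. m * s \<in> Q) \<and> (\<forall>a. (\<forall>m\<in>M. m * a \<in> Q) \<longrightarrow> (\<exists>c. a - c * s \<in> Q))))"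
  (is "?l \<longleftrightarrow> ?r")
proof -
  interpret cring "ring_of_type_algebra :: 'p ring" by (rule cring_from_type_algebra)
  interpret Q: ideal Q "ring_of_type_algebra :: 'p ring" by fact
  let ?R = "ring_of_type_algebra :: 'p ring"
  let ?S = "?R Quot Q"
  let ?q = "\<lambda>a. Q +>\<^bsub>?R\<^esub> a"
  have S: "cring ?S" by (rule Q.quotient_is_cring[OF is_cring])
  have car: "carrier ?S = range ?q" unfolding FactRing_def A_RCOSETS_def' by auto
  have mult: "?q a \<otimes>\<^bsub>?S\<^esub> ?q b = ?q (a * b)" for a b
    using Q.rcoset_mult_add[of a b] by (simp add: FactRing_def)
  have zero: "\<zero>\<^bsub>?S\<^esub> = Q" by (simp add: FactRing_def)
  have eq: "?q a = ?q b \<longleftrightarrow> a - b \<in> Q" for a b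
    using quotient_eq_iff_same_a_r_cos[OF Q, of a b] by (simp add: a_minus_def)
  have q0: "?q a = Q \<longleftrightarrow> a \<in> Q" for a
    using eq[of a 0] a_coset_add_zero[OF Q.a_subset] by simp
  have soc: "?q a \<in> socle ?S (?q ` M) \<longleftrightarrow> (\<forall>m\<in>M. m * a \<in> Q)" for a M
    unfolding socle_def car zero by (simp add: mult q0)
  have sub: "socle ?S (?q ` M) \<subseteq> range ?q" for M
    unfolding socle_def car by blast
  have ball: "(\<forall>x\<in>socle ?S (?q ` M). P x) \<longleftrightarrow> (\<forall>a. (\<forall>m\<in>M. m * a \<in> Q) \<longrightarrow> P (?q a))"
    and bex: "(\<exists>x\<in>socle ?S (?q ` M). P x) \<longleftrightarrow> (\<exists>a. (\<forall>m\<in>M. m * a \<in> Q) \<and> P (?q a))" for P M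
    unfolding soc[symmetric] using sub[of M] by blast+
  have one_dim: "(\<exists>s\<in>socle ?S (?q ` M). s \<noteq> \<zero>\<^bsub>?S\<^esub> \<and>
      (\<forall>a\<in>socle ?S (?q ` M). \<exists>x\<in>carrier ?S. a = x \<otimes>\<^bsub>?S\<^esub> s)) \<longleftrightarrow>
    (\<exists>s. s \<notin> Q \<and> (\<forall>m\<in>M. m * s \<in> Q) \<and> (\<forall>a. (\<forall>m\<in>M. m * a \<in> Q) \<longrightarrow> (\<exists>c. a - c * s \<in> Q)))" for M
    unfolding ball bex zero car by (simp add: mult q0 eq) blast
  have inj: "M = M'" if "?q ` M = ?q ` M'" "Q \<subseteq> M" "Q \<subseteq> M'"
      "maximalideal M ?R" "maximalideal M' ?R" for M M'
  proof -
    have "ideal M ?R" "ideal M' ?R" using that(4,5) by (auto dest: maximalideal.axioms)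
    then have "M = \<Union> (?q ` M)" "M' = \<Union> (?q ` M')" using ideal_incl_iff[OF Q] that by blast+
    then show ?thesis using that(1) by simp
  qed
  define D where "D \<mm> \<longleftrightarrow> (\<exists>s\<in>socle ?S \<mm>. s \<noteq> \<zero>\<^bsub>?S\<^esub> \<and>
      (\<forall>a\<in>socle ?S \<mm>. \<exists>x\<in>carrier ?S. a = x \<otimes>\<^bsub>?S\<^esub> s))" for \<mm>
  have "?l \<longleftrightarrow> (\<exists>\<mm>. (\<exists>M. maximalideal M ?R \<and> Q \<subseteq> M \<and> \<mm> = ?q ` M) \<and>
      (\<forall>\<mm>'. (\<exists>M. maximalideal M ?R \<and> Q \<subseteq> M \<and> \<mm>' = ?q ` M) \<longrightarrow> \<mm>' = \<mm>) \<and> D \<mm>)"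
    unfolding gorenstein_local_ring_iff maximalideal_Quot_iff[OF Q] D_def by (simp only: S simp_thms)
  also have "\<dots> \<longleftrightarrow> (\<exists>M. maximalideal M ?R \<and> Q \<subseteq> M \<and>
      (\<forall>M'. maximalideal M' ?R \<and> Q \<subseteq> M' \<longrightarrow> ?q ` M' = ?q ` M) \<and> D (?q ` M))"
  proof -
    have "(\<exists>m. (\<exists>M. A M \<and> B M \<and> m = f M) \<and> (\<forall>m'. (\<exists>M. A M \<and> B M \<and> m' = f M) \<longrightarrow> m' = m) \<and> E m)
      \<longleftrightarrow> (\<exists>M. A M \<and> B M \<and> (\<forall>M'. A M' \<and> B M' \<longrightarrow> f M' = f M) \<and> E (f M))"
      for A B E and f :: "'p set \<Rightarrow> 'p set set" by auto
    then show ?thesis .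
  qed
  also have "\<dots> \<longleftrightarrow> ?r"
    unfolding D_def one_dim
  proof (intro ex_cong1 conj_cong refl)
    fix M assume M: "maximalideal M ?R" "Q \<subseteq> M"
    show "(\<forall>M'. maximalideal M' ?R \<and> Q \<subseteq> M' \<longrightarrow> ?q ` M' = ?q ` M) \<longleftrightarrow>
        (\<forall>M'. maximalideal M' ?R \<and> Q \<subseteq> M' \<longrightarrow> M' = M)"
      using inj[OF _ _ M(2) _ M(1)] by (intro all_cong1 imp_cong refl iffI) simp_all
  qed
  finally show ?thesis .
qed

section \<open>Socles of locally Gorenstein rings\<close>

lemma ideal_closed:
  fixes J :: "'p::comm_ring_1 set"
  assumes "ideal J ring_of_type_algebra"
  shows "0 \<in> J" "a \<in> J \<Longrightarrow> b \<in> J \<Longrightarrow> a + b \<in> J" "a \<in> J \<Longrightarrow> x * a \<in> J" "a \<in> J \<Longrightarrow> a * x \<in> J"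
    "a \<in> J \<Longrightarrow> b \<in> J \<Longrightarrow> a - b \<in> J"
proof -
  note * = assms[unfolded ideal_ring_of_type_algebra_iff]
  show "0 \<in> J" "a \<in> J \<Longrightarrow> b \<in> J \<Longrightarrow> a + b \<in> J" "a \<in> J \<Longrightarrow> x * a \<in> J" "a \<in> J \<Longrightarrow> a * x \<in> J"
    using * by (auto simp: mult.commute[of a x])
  have "b \<in> J \<Longrightarrow> - b \<in> J" using * by (metis mult_minus1)
  then show "a \<in> J \<Longrightarrow> b \<in> J \<Longrightarrow> a - b \<in> J" using * by (metis add_uminus_conv_diff)
qed

text \<open>
  An element outside \<open>I\<close> that is killed by \<open>M\<close> modulo \<open>I\<close> has the annihilator \<open>M\<close>; so the property
  concerns exactly the socles of the localisations of the quotient by \<open>I\<close> at maximal ideals.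
\<close>

definition cyclic_socles :: "'p::comm_ring_1 set \<Rightarrow> bool" where
  "cyclic_socles I \<longleftrightarrow> (\<forall>M a b. maximalideal M ring_of_type_algebra \<longrightarrow>
     (\<forall>m\<in>M. m * a \<in> I) \<longrightarrow> (\<forall>m\<in>M. m * b \<in> I) \<longrightarrow> b \<notin> I \<longrightarrow> (\<exists>c. a - c * b \<in> I))"

lemma maximalideal_inverse:
  fixes M :: "'p::comm_ring_1 set"
  assumes "maximalideal M ring_of_type_algebra" "x \<notin> M"
  obtains y where "1 - x * y \<in> M"
  using assms by (auto simp: maximalideal_ring_of_type_algebra_iff)

lemma socle_annihilator:
  fixes M :: "'p::comm_ring_1 set"
  assumes J: "ideal J ring_of_type_algebra" and M: "maximalideal M ring_of_type_algebra"
    and s: "\<forall>m\<in>M. m * s \<in> J" "s \<notin> J" and c: "c * s \<in> J"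
  shows "c \<in> M"
proof (rule ccontr)
  assume "c \<notin> M"
  then obtain y where "1 - c * y \<in> M" by (rule maximalideal_inverse[OF M])
  then have "(1 - c * y) * s + y * (c * s) \<in> J" using s(1) c ideal_closed(2,3)[OF J] by blast
  then show False using s(2) by (simp add: algebra_simps)
qed

text \<open>
  This detects the component in which a
  given socle element of \<open>I\<close> survives.
\<close>

lemma primary_ideal_socle:
  fixes M :: "'p::comm_ring_1 set"
  assumes Q: "primary_ideal ring_of_type_algebra Q" and M: "maximalideal M ring_of_type_algebra"
    and b: "\<forall>m\<in>M. m * b \<in> Q" "b \<notin> Q"
  shows "M \<subseteq> ideal_radical ring_of_type_algebra Q"
proof
  fix m assume "m \<in> M"
  then have "b * m \<in> Q" using b(1) by (auto simp: mult.commute)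
  then show "m \<in> ideal_radical ring_of_type_algebra Q"
    using Q b(2) unfolding primary_ideal_def by auto
qed

lemma radical_subset_maximalideal:
  fixes M :: "'p::comm_ring_1 set"
  assumes "maximalideal M ring_of_type_algebra" "Q \<subseteq> M"
  shows "ideal_radical ring_of_type_algebra Q \<subseteq> M"
  using assms maximalideal_power_elem[OF assms(1)] by (auto simp: ideal_radical_def)

lemma maximalideal_eqI:
  assumes "maximalideal M ring_of_type_algebra" "maximalideal M' ring_of_type_algebra"
    "M \<subseteq> M'"
  shows "M = (M' :: 'p::comm_ring_1 set)"
proof -
  interpret M: maximalideal M ring_of_type_algebra by fact
  interpret M': maximalideal M' ring_of_type_algebra by fact
  show ?thesis using M.I_maximal[OF M'.is_ideal assms(3)] M'.I_notcarr by simp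
qed

text \<open>
  Let \<open>a\<close>, \<open>b\<close> be in the \<open>M\<close>-socle of \<open>I\<close>.  Any component that does not contain a given \<open>M\<close>-socle element
  has the radical \<open>M\<close>, and there is only one such component \<open>Q\<close>.  If \<open>b\<close> is not in \<open>I\<close>, it is not in \<open>Q\<close>,
  so it generates the socle modulo \<open>Q\<close>, and \<open>a\<close> is a multiple of \<open>b\<close> modulo \<open>Q\<close>.  The difference lies in
  all other components as well, hence in \<open>I\<close>.
\<close>

lemma locally_gorenstein_imp_cyclic_socles:
  fixes I :: "'p::comm_ring_1 set"
  assumes "locally_gorenstein ring_of_type_algebra I"
  shows "cyclic_socles I"
  unfolding cyclic_socles_def
proof (intro allI impI)
  let ?R = "ring_of_type_algebra :: 'p ring"
  fix M :: "'p set" and a b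
  assume M: "maximalideal M ?R" and a: "\<forall>m\<in>M. m * a \<in> I" and b: "\<forall>m\<in>M. m * b \<in> I" "b \<notin> I"
  obtain Qs where Qs: "primary_decomposition ?R I Qs"
    and gor: "\<And>Q. Q \<in> Qs \<Longrightarrow> gorenstein_local_ring (?R Quot Q)"
    using assms by (auto simp: locally_gorenstein_def)
  have I: "I = \<Inter>Qs" and prim: "\<And>Q. Q \<in> Qs \<Longrightarrow> primary_ideal ?R Q"
    and inj: "inj_on (ideal_radical ?R) Qs"
    using Qs by (auto simp: primary_decomposition_def)
  have sub: "I \<subseteq> Q" if "Q \<in> Qs" for Q using I that by blast
  have id: "ideal Q ?R" if "Q \<in> Qs" for Q using prim[OF that] by (simp add: primary_ideal_def)
  have max: "\<exists>M'. maximalideal M' ?R \<and> Q \<subseteq> M' \<and> (\<exists>s. s \<notin> Q \<and> (\<forall>m\<in>M'. m * s \<in> Q) \<and>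
      (\<forall>a. (\<forall>m\<in>M'. m * a \<in> Q) \<longrightarrow> (\<exists>c. a - c * s \<in> Q)))" if "Q \<in> Qs" for Q
    using gor[OF that] unfolding gorenstein_local_ring_Quot_iff[OF id[OF that]] by blast
  have rad: "ideal_radical ?R Q = M \<and> Q \<subseteq> M" if Q: "Q \<in> Qs" and x: "\<forall>m\<in>M. m * x \<in> I" "x \<notin> Q" for Q x
  proof -
    have sub1: "M \<subseteq> ideal_radical ?R Q"
      using primary_ideal_socle[OF prim[OF Q] M _ x(2)] x(1) sub[OF Q] by blast
    obtain M' where M': "maximalideal M' ?R" "Q \<subseteq> M'" using max[OF Q] by blast
    have sub2: "ideal_radical ?R Q \<subseteq> M'" by (rule radical_subset_maximalideal[OF M'])
    have "M = M'" by (rule maximalideal_eqI[OF M M'(1)]) (use sub1 sub2 in blast)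
    then show ?thesis using sub1 sub2 M'(2) by blast
  qed
  obtain Q where Q: "Q \<in> Qs" "b \<notin> Q" using b(2) I by blast
  note radQ = rad[OF Q(1) b(1) Q(2)]
  \<comment> \<open>\<open>s\<close> generates the socle modulo \<open>Q\<close>; the coefficient \<open>d\<close> of \<open>b\<close> is invertible modulo \<open>M\<close>.\<close>
  obtain M' s where M': "maximalideal M' ?R" "Q \<subseteq> M'" and s: "s \<notin> Q" "\<forall>m\<in>M'. m * s \<in> Q"
    "\<And>a. \<forall>m\<in>M'. m * a \<in> Q \<Longrightarrow> \<exists>c. a - c * s \<in> Q" using max[OF Q(1)] by blast
  have "M = M'"
    using maximalideal_eqI[OF M M'(1)] radical_subset_maximalideal[OF M'] radQ by blast
  then obtain c d where c: "a - c * s \<in> Q" and d: "b - d * s \<in> Q"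
    using s(3)[of a] s(3)[of b] a b(1) sub[OF Q(1)] by blast
  note cl = ideal_closed[OF id[OF Q(1)]]
  have "d \<notin> M"
  proof
    assume "d \<in> M"
    then have "b - d * s + d * s \<in> Q" using s(2) d cl(2) \<open>M = M'\<close> by blast
    then show False using Q(2) by simp
  qed
  then obtain e where e: "1 - d * e \<in> M" by (rule maximalideal_inverse[OF M])
  let ?x = "a - (c * e) * b"
  have "?x = (a - c * s) + c * ((1 - d * e) * s) - (c * e) * (b - d * s)" by (simp add: algebra_simps)
  then have xQ: "?x \<in> Q" using c d e s(2) \<open>M = M'\<close> cl by metis
  have xM: "\<forall>m\<in>M. m * ?x \<in> I"
  proof
    fix m assume m: "m \<in> M"
    have "m * ?x \<in> Q'" if "Q' \<in> Qs" for Q'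
    proof -
      have "m * a \<in> Q'" "m * b \<in> Q'" using a b(1) m sub[OF that] by auto
      then have "m * a - (c * e) * (m * b) \<in> Q'" 
        by (rule ideal_closed(5)[OF id[OF that] _ ideal_closed(3)[OF id[OF that]]])
      then show ?thesis by (simp add: algebra_simps)
    qed
    then show "m * ?x \<in> I" using I by blast
  qed
  have "?x \<in> Q'" if Q': "Q' \<in> Qs" for Q'
  proof (rule ccontr)
    assume x: "?x \<notin> Q'"
    then have "ideal_radical ?R Q' = ideal_radical ?R Q" using rad[OF Q' xM] radQ by blast
    then have "Q' = Q" using inj Q' Q(1) by (auto dest: inj_onD)
    then show False using xQ x by blast
  qed
  then show "\<exists>c. a - c * b \<in> I" using I by blast
qed

section \<open>Primary decomposition in Artinian quotients\<close>

text \<open>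
  The descending chain condition for the ideals above \<open>I\<close>, in the form of existence of minimal elements.
\<close>

locale artinian_quotient =
  fixes I :: "'p::comm_ring_1 set"
  assumes ideal_I: "ideal I ring_of_type_algebra"
    and dcc: "\<And>S. S \<noteq> {} \<Longrightarrow> (\<And>J. J \<in> S \<Longrightarrow> ideal J ring_of_type_algebra \<and> I \<subseteq> J) \<Longrightarrow>
      \<exists>J\<in>S. \<forall>J'\<in>S. J' \<subseteq> J \<longrightarrow> J' = J"
begin

abbreviation R where "R \<equiv> (ring_of_type_algebra :: 'p ring)"

lemmas cl = ideal_closed[OF ideal_I]

text \<open>
  This is how the chain condition is used below: a set of ring elements contains an \<open>x\<close> such that \<open>I + (x)\<close> is
  minimal, and then \<open>x\<close> is recovered modulo \<open>I\<close> from each of its multiples in the set.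
\<close>

lemma ex_minimal_multiple:
  assumes "T \<noteq> {}"
  shows "\<exists>x\<in>T. \<forall>y. x * y \<in> T \<longrightarrow> (\<exists>z. x - x * y * z \<in> I)"
proof -
  define P where "P x = {i + x * y | i y. i \<in> I}" for x
  have PI: "i + x * y \<in> P x" if "i \<in> I" for i x y using that by (auto simp: P_def)
  have PE: "\<exists>i y. i \<in> I \<and> a = i + x * y" if "a \<in> P x" for a x using that by (auto simp: P_def)
  have ideal_P: "ideal (P x) R \<and> I \<subseteq> P x" for x
  proof
    show "ideal (P x) R" unfolding ideal_ring_of_type_algebra_iff
    proof (intro conjI ballI allI)
      show "0 \<in> P x" using PI[of 0 x 0] cl(1) by simp
      fix a assume "a \<in> P x" then obtain i y where a: "a = i + x * y" "i \<in> I" using PE by blast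
      show "z * a \<in> P x" for z
        using PI[of "z * i" x "z * y"] a cl(3) by (simp add: algebra_simps)
      fix b assume "b \<in> P x" then obtain i' y' where b: "b = i' + x * y'" "i' \<in> I" using PE by blast
      show "a + b \<in> P x"
        using PI[of "i + i'" x "y + y'"] a b cl(2) by (simp add: algebra_simps)
    qed
    show "I \<subseteq> P x" using PI[of _ x 0] by auto
  qed
  have "\<exists>J\<in>P ` T. \<forall>J'\<in>P ` T. J' \<subseteq> J \<longrightarrow> J' = J"
    by (rule dcc) (use assms ideal_P in auto)
  then obtain x where x: "x \<in> T" and min: "\<And>x'. x' \<in> T \<Longrightarrow> P x' \<subseteq> P x \<Longrightarrow> P x' = P x"
    by auto
  have "\<exists>z. x - x * y * z \<in> I" if y: "x * y \<in> T" for y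
  proof -
    have "P (x * y) \<subseteq> P x"
    proof
      fix a assume "a \<in> P (x * y)"
      then obtain i z where "a = i + x * y * z" "i \<in> I" using PE by blast
      then show "a \<in> P x" using PI[of i x "y * z"] by (simp add: mult.assoc)
    qed
    then have "P (x * y) = P x" using min y by blast
    then have "x \<in> P (x * y)" using PI[of 0 x 1] cl(1) by simp
    then obtain i z where "i \<in> I" "x = i + x * y * z" using PE by blast
    then show ?thesis by (metis add_diff_cancel_right')
  qed
  then show ?thesis using x by blast
qed

text \<open>
  Every nonzero ideal of the quotient contains a minimal one.  For a generator \<open>s\<close> of a minimal
  ideal, every \<open>y\<close> with \<open>s y \<notin> I\<close> satisfies \<open>s - s y z \<in> I\<close> for some \<open>z\<close>, which says that the annihilator of
  \<open>s\<close> is maximal.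
\<close>

lemma ex_socle_multiple:
  assumes "f \<notin> I"
  obtains h where "f * h \<notin> I" "maximalideal {c. c * (f * h) \<in> I} R"
proof -
  let ?T = "{f * h | h. f * h \<notin> I}"
  have "f * 1 \<in> ?T" using assms by (intro CollectI exI[of _ 1]) simp
  then have "?T \<noteq> {}" by blast
  from ex_minimal_multiple[OF this] obtain x where
    x: "x \<in> ?T" "\<forall>y. x * y \<in> ?T \<longrightarrow> (\<exists>z. x - x * y * z \<in> I)" by (elim bexE)
  obtain h where xh: "x = f * h" and h: "f * h \<notin> I" using x(1) by blast
  have min: "\<exists>z. f * h - f * h * y * z \<in> I" if "f * h * y \<notin> I" for y
  proof -
    have "x * y \<in> ?T" using that xh by (intro CollectI exI[of _ "h * y"]) (simp add: mult.assoc)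
    then show ?thesis using x(2) unfolding xh by simp
  qed
  let ?s = "f * h"
  have "maximalideal {c. c * ?s \<in> I} R"
    unfolding maximalideal_ring_of_type_algebra_iff ideal_ring_of_type_algebra_iff
  proof (intro conjI allI ballI impI)
    show "0 \<in> {c. c * ?s \<in> I}" "1 \<notin> {c. c * ?s \<in> I}" using h cl(1) by auto
    fix a assume a: "a \<in> {c. c * ?s \<in> I}"
    show "a + b \<in> {c. c * ?s \<in> I}" if "b \<in> {c. c * ?s \<in> I}" for b
      using that a cl(2) by (auto simp: distrib_right)
    show "x * a \<in> {c. c * ?s \<in> I}" for x
      using a cl(3)[of "a * ?s" x] by (simp add: mult.assoc)
  next
    fix y assume "y \<notin> {c. c * ?s \<in> I}"
    then obtain z where "?s - ?s * y * z \<in> I" using min[of y] by (auto simp: mult.commute)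
    then show "\<exists>z. 1 - y * z \<in> {c. c * ?s \<in> I}"
      by (intro exI[of _ z]) (simp add: algebra_simps)
  qed
  then show ?thesis using that h by blast
qed

text \<open>
  The kernel of the localisation of the quotient by \<open>I\<close> at \<open>M\<close>; it turns out to be the \<open>M\<close>-primary component of \<open>I\<close>.
\<close>

definition component :: "'p set \<Rightarrow> 'p set" where
  "component M = {f. \<exists>g. g \<notin> M \<and> g * f \<in> I}"

context
  fixes M assumes M: "maximalideal M R" and IM: "I \<subseteq> M"
begin

lemma ideal_M: "ideal M R" using M by (rule maximalideal.axioms)

text \<open>
  A single denominator suffices: take \<open>g \<notin> M\<close> with \<open>I + (g)\<close> minimal.  If \<open>g'\<close> is another denominator,
  then \<open>g\<close> is a multiple of \<open>g g'\<close> modulo \<open>I\<close> and kills whatever \<open>g'\<close> kills.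
\<close>

lemma ex_localizer: "\<exists>g. g \<notin> M \<and> component M = {f. g * f \<in> I}"
proof -
  have "1 \<notin> M" using M by (simp add: maximalideal_ring_of_type_algebra_iff)
  then obtain g where g: "g \<notin> M" and min: "\<And>y. g * y \<notin> M \<Longrightarrow> \<exists>z. g - g * y * z \<in> I"
    using ex_minimal_multiple[of "- M"] by auto
  have "g * f \<in> I" if "g' \<notin> M" "g' * f \<in> I" for f g'
  proof -
    have "g * g' \<notin> M" using maximalideal_prime_elem[OF M] g that(1) by blast
    then obtain z where "g - g * g' * z \<in> I" using min by blast
    then have "f * (g - g * g' * z) + (g * z) * (g' * f) \<in> I" using that(2) cl by blast
    then show ?thesis by (simp add: algebra_simps)
  qed
  then show ?thesis using g by (auto simp: component_def)
qed

lemma ideal_component: "ideal (component M) R"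
proof -
  obtain g where g: "component M = {f. g * f \<in> I}" using ex_localizer by blast
  show ?thesis unfolding g ideal_ring_of_type_algebra_iff
    using cl by (auto simp: distrib_left mult.left_commute)
qed

lemma component_subset: "component M \<subseteq> M"
  using maximalideal_prime_elem[OF M] IM by (auto simp: component_def)

text \<open>
  The powers of \<open>x\<close> generate a descending chain of ideals, so \<open>x\<^sup>k (1 - x z) \<in> I\<close> for some \<open>k\<close> and \<open>z\<close>,
  and \<open>1 - x z \<notin> M\<close>.
\<close>

lemma power_in_component:
  assumes "x \<in> M" shows "\<exists>k. x ^ k \<in> component M"
proof -
  obtain k where "\<forall>y. x ^ k * y \<in> range ((^) x) \<longrightarrow> (\<exists>z. x ^ k - x ^ k * y * z \<in> I)"
    using ex_minimal_multiple[of "range ((^) x)"] by auto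
  moreover have "x ^ k * x \<in> range ((^) x)" by (metis power_Suc2 rangeI)
  ultimately obtain z where z: "x ^ k - x ^ k * x * z \<in> I" by blast
  have "1 - x * z \<notin> M"
  proof
    assume "1 - x * z \<in> M"
    then have "1 - x * z + x * z \<in> M" using assms ideal_closed[OF ideal_M] by blast
    then show False using M by (simp add: maximalideal_ring_of_type_algebra_iff)
  qed
  moreover have "(1 - x * z) * x ^ k \<in> I" using z by (simp add: algebra_simps)
  ultimately show ?thesis by (auto simp: component_def)
qed

lemma radical_component: "ideal_radical R (component M) = M"
proof
  show "ideal_radical R (component M) \<subseteq> M"
    by (rule radical_subset_maximalideal[OF M component_subset])
  show "M \<subseteq> ideal_radical R (component M)"
    using power_in_component by (auto simp: ideal_radical_def)
qed

lemma primary_component: "primary_ideal R (component M)"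
  unfolding primary_ideal_def radical_component
proof (intro conjI ballI impI)
  show "ideal (component M) R" by (rule ideal_component)
  show "component M \<noteq> carrier R"
    using component_subset M by (auto simp: maximalideal_ring_of_type_algebra_iff)
  fix a b assume "a \<otimes>\<^bsub>R\<^esub> b \<in> component M"
  then obtain g where g: "g \<notin> M" "g * (a * b) \<in> I" by (auto simp: component_def)
  show "a \<in> component M \<or> b \<in> M"
  proof (rule disjCI)
    assume "b \<notin> M"
    then have "g * b \<notin> M" using g(1) maximalideal_prime_elem[OF M] by blast
    moreover have "(g * b) * a \<in> I" using g(2) by (simp add: mult_ac)
    ultimately show "a \<in> component M" by (auto simp: component_def)
  qed
qed

text \<open>
  A denominator \<open>g\<close> for the component of \<open>M\<close> lies outside \<open>I\<close>.  A minimal ideal inside \<open>(g)\<close> is killed by the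
  component of \<open>M\<close>, so its annihilator, being maximal, is \<open>M\<close>.
\<close>

lemma ex_socle_element: "\<exists>s. s \<notin> I \<and> (\<forall>m\<in>M. m * s \<in> I)"
proof -
  obtain g where g: "g \<notin> M" "component M = {f. g * f \<in> I}" using ex_localizer by blast
  have "g \<notin> I" using g IM by blast
  then obtain h where h: "g * h \<notin> I" "maximalideal {c. c * (g * h) \<in> I} R"
    by (rule ex_socle_multiple)
  let ?M' = "{c. c * (g * h) \<in> I}"
  have "component M \<subseteq> ?M'"
  proof
    fix f assume "f \<in> component M"
    then have "(g * f) * h \<in> I" using g cl by blast
    then show "f \<in> ?M'" by (simp add: mult_ac)
  qed
  then have "M \<subseteq> ?M'" using radical_subset_maximalideal[OF h(2)] radical_component by blast
  then show ?thesis using h(1) by blast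
qed

text \<open>
  Multiplication by a denominator \<open>g\<close> maps the socle modulo the component into the \<open>M\<close>-socle of \<open>I\<close>, and \<open>g\<close> is
  invertible modulo \<open>M\<close>; so the socle modulo the component is generated by the \<open>M\<close>-socle of \<open>I\<close>.
\<close>

lemma gorenstein_component:
  assumes "cyclic_socles I"
  shows "gorenstein_local_ring (R Quot component M)"
  unfolding gorenstein_local_ring_Quot_iff[OF ideal_component]
proof (intro exI[of _ M] conjI allI impI)
  show "M' = M" if M': "maximalideal M' R \<and> component M \<subseteq> M'" for M'
  proof -
    have "M \<subseteq> M'" using radical_subset_maximalideal[of M' "component M"] M' radical_component by simp
    then show ?thesis using maximalideal_eqI[OF M, of M'] M' by simp
  qed
  obtain g where g: "g \<notin> M" "component M = {f. g * f \<in> I}" using ex_localizer by blast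
  obtain s where s: "s \<notin> I" "\<forall>m\<in>M. m * s \<in> I" using ex_socle_element by blast
  have "s \<notin> component M"
    using socle_annihilator[OF ideal_I M s(2,1)] by (auto simp: component_def)
  moreover have "m * s \<in> component M" if "m \<in> M" for m
    using that s(2) g cl by simp
  moreover have "\<exists>c. a - c * s \<in> component M" if a: "\<forall>m\<in>M. m * a \<in> component M" for a
  proof -
    have "\<forall>m\<in>M. m * (g * a) \<in> I" using a g(2) by (simp add: mult.left_commute)
    then obtain c where c: "g * a - c * s \<in> I"
      using assms M s unfolding cyclic_socles_def by blast
    obtain y where y: "1 - g * y \<in> M" by (rule maximalideal_inverse[OF M g(1)])
    have "(1 - g * y) * a \<in> component M" using a y by blast
    then have "g * ((1 - g * y) * a) \<in> I" unfolding g(2) by simp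
    then have "g * ((1 - g * y) * a) + (g * y) * (g * a - c * s) \<in> I" by (rule cl(2)[OF _ cl(3)[OF c]])
    then have "g * (a - (y * c) * s) \<in> I" by (simp add: algebra_simps)
    then show ?thesis using g(2) by blast
  qed
  ultimately show "\<exists>s. s \<notin> component M \<and> (\<forall>m\<in>M. m * s \<in> component M) \<and>
      (\<forall>a. (\<forall>m\<in>M. m * a \<in> component M) \<longrightarrow> (\<exists>c. a - c * s \<in> component M))" by blast
  show "maximalideal M R" by (rule M)
  show "component M \<subseteq> M" by (rule component_subset)
qed

end

lemma Inter_subset_maximalideal:
  assumes M: "maximalideal M R" and "finite S" "\<Inter>S \<subseteq> M" "\<And>J. J \<in> S \<Longrightarrow> ideal J R"
  shows "\<exists>J\<in>S. J \<subseteq> M"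
  using assms(2-4)
proof (induction S)
  case empty
  then show ?case using M by (auto simp: maximalideal_ring_of_type_algebra_iff)
next
  case (insert J S)
  show ?case
  proof (cases "J \<subseteq> M")
    case False
    then obtain x where x: "x \<in> J" "x \<notin> M" by blast
    have "\<Inter>S \<subseteq> M"
    proof
      fix y assume y: "y \<in> \<Inter>S"
      have "x * y \<in> J'" if "J' \<in> insert J S" for J'
        using that y x(1) ideal_closed(3,4)[OF insert.prems(2)[OF that]] by blast
      then have "x * y \<in> M" using insert.prems(1) by blast
      then show "y \<in> M" using maximalideal_prime_elem[OF M] x(2) by blast
    qed
    then show ?thesis using insert by blast
  qed blast
qed

text \<open>
  A minimal finite intersection of maximal ideals is contained in every maximal ideal above \<open>I\<close>, so all of
  them occur in it.
\<close>

lemma finite_maximalideals: "finite {M. maximalideal M R \<and> I \<subseteq> M}" (is "finite ?X")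
proof -
  have id: "ideal M R" if "M \<in> ?X" for M using that by (auto dest: maximalideal.axioms)
  have "ideal (\<Inter>S) R \<and> I \<subseteq> \<Inter>S" if "S \<subseteq> ?X" for S
  proof
    have *: "ideal J R" if "J \<in> S" for J using id \<open>S \<subseteq> ?X\<close> that by blast
    show "ideal (\<Inter>S) R" unfolding ideal_ring_of_type_algebra_iff
      using ideal_closed[OF *] by blast
    show "I \<subseteq> \<Inter>S" using that by blast
  qed
  note ideal_Inter = this
  define F where "F = {S. finite S \<and> S \<subseteq> ?X}"
  have "\<exists>J\<in>Inter ` F. \<forall>J'\<in>Inter ` F. J' \<subseteq> J \<longrightarrow> J' = J"
  proof (rule dcc)
    have "{} \<in> F" by (simp add: F_def)
    then show "Inter ` F \<noteq> {}" by blast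
  qed (use ideal_Inter in \<open>auto simp: F_def\<close>)
  then obtain S where S': "S \<in> F" and min: "\<And>S'. S' \<in> F \<Longrightarrow> \<Inter>S' \<subseteq> \<Inter>S \<Longrightarrow> \<Inter>S' = \<Inter>S"
    by (auto simp only: bex_simps ball_simps)
  have S: "finite S" "S \<subseteq> ?X" using S' by (simp_all add: F_def)
  have "M \<in> S" if M: "M \<in> ?X" for M
  proof -
    have "insert M S \<in> F" using S M unfolding F_def by blast
    then have "\<Inter>(insert M S) = \<Inter>S" by (rule min) blast
    then have "\<Inter>S \<subseteq> M" by blast
    then obtain J where J: "J \<in> S" "J \<subseteq> M"
      using Inter_subset_maximalideal[of M S] M S id by blast
    then have "J = M" using maximalideal_eqI[of J M] M S(2) by blast
    then show ?thesis using J by simp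
  qed
  then show ?thesis using S(1) by (meson finite_subset subsetI)
qed

text \<open>
  The components at the maximal ideals above \<open>I\<close> form the primary decomposition.  An element \<open>f \<notin> I\<close> has
  a multiple whose annihilator \<open>M\<close> is maximal, and then \<open>f\<close> is not in the component of \<open>M\<close>.  No component can
  be omitted: otherwise one of the others would be contained in \<open>M\<close>, and \<open>M\<close> would be its radical.
\<close>

lemma cyclic_socles_imp_locally_gorenstein:
  assumes "cyclic_socles I"
  shows "locally_gorenstein R I"
proof -
  let ?X = "{M. maximalideal M R \<and> I \<subseteq> M}"
  let ?Qs = "component ` ?X"
  have fin: "finite ?Qs" using finite_maximalideals by simp
  have I: "\<Inter>?Qs = I"
  proof
    show "I \<subseteq> \<Inter>?Qs"
    proof (intro Inter_greatest, clarify)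
      fix i M assume "i \<in> I" "maximalideal M R"
      then show "i \<in> component M"
        by (auto simp: component_def maximalideal_ring_of_type_algebra_iff intro!: exI[of _ 1])
    qed
    show "\<Inter>?Qs \<subseteq> I"
    proof
      fix f assume f: "f \<in> \<Inter>?Qs"
      show "f \<in> I"
      proof (rule ccontr)
        assume "f \<notin> I"
        then obtain h where h: "f * h \<notin> I" "maximalideal {c. c * (f * h) \<in> I} R"
          by (rule ex_socle_multiple)
        let ?M = "{c. c * (f * h) \<in> I}"
        have "I \<subseteq> ?M" using cl by blast
        then have "f \<in> component ?M" using f h(2) by blast
        then obtain g where g: "g \<notin> ?M" "g * f \<in> I" by (auto simp: component_def)
        then have "(g * f) * h \<in> I" using cl by blast
        then show False using g(1) by (simp add: mult.assoc)
      qed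
    qed
  qed
  have irr: "I \<noteq> \<Inter>(?Qs - {Q})" if Q: "Q \<in> ?Qs" for Q
  proof
    obtain M where M: "maximalideal M R" "I \<subseteq> M" "Q = component M" using Q by blast
    assume "I = \<Inter>(?Qs - {Q})"
    then have "\<Inter>(?Qs - {Q}) \<subseteq> M" using M by blast
    have "\<exists>J\<in>?Qs - {Q}. J \<subseteq> M"
    proof (rule Inter_subset_maximalideal[OF M(1)])
      show "\<Inter>(?Qs - {Q}) \<subseteq> M" by fact
      show "ideal J R" if J: "J \<in> ?Qs - {Q}" for J
      proof -
        obtain M' where "maximalideal M' R" "I \<subseteq> M'" "J = component M'" using J by blast
        then show ?thesis using ideal_component[of M'] by simp
      qed
    qed (use fin in simp)
    then obtain J where J: "J \<in> ?Qs - {Q}" "J \<subseteq> M" by blast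
    then obtain M' where M': "maximalideal M' R" "I \<subseteq> M'" "J = component M'" by blast
    have "M' \<subseteq> M" using radical_subset_maximalideal[OF M(1) J(2)] M' radical_component by simp
    then have "M' = M" by (rule maximalideal_eqI[OF M'(1) M(1)])
    then show False using J(1) M' M by blast
  qed
  have "primary_decomposition R I ?Qs"
    unfolding primary_decomposition_def
  proof (intro conjI ballI)
    show "finite ?Qs" by (rule fin)
    show "I = carrier R \<inter> \<Inter>?Qs" using I by simp
    show "inj_on (ideal_radical R) ?Qs"
      by (rule inj_onI) (auto simp: radical_component)
    fix Q assume Q: "Q \<in> ?Qs"
    then show "primary_ideal R Q" using primary_component by blast
    show "I \<noteq> carrier R \<inter> \<Inter>(?Qs - {Q})" using irr[OF Q] by simp
  qed
  then show ?thesis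
    unfolding locally_gorenstein_def using gorenstein_component[OF _ _ assms]
    by (intro exI[of _ ?Qs]) simp
qed

end

section \<open>Evaluation of polynomials\<close>

lemma poly_mapping_additive_induct [case_names single add]:
  assumes "\<And>s a. P (Poly_Mapping.single s a)" "\<And>f g. P f \<Longrightarrow> P g \<Longrightarrow> P (f + g)"
  shows "P (f :: 's \<Rightarrow>\<^sub>0 'a::comm_monoid_add)"
proof (induction f rule: update_induct)
  case const
  show ?case using assms(1)[of undefined 0] by simp
next
  case (update f a b)
  have "Poly_Mapping.update a b f = f + Poly_Mapping.single a b"
    using update(1)
    by (intro poly_mapping_eqI) (auto simp: lookup_update lookup_add lookup_single in_keys_iff when_def)
  then show ?case using assms update(3) by simp
qed

lemma pterm_induct [case_names zero pvar]:
  assumes "P 0" "\<And>r s. P s \<Longrightarrow> P (pvar r + s)"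
  shows "P (s :: 'x pterm)"
proof -
  have "\<forall>u. P u \<longrightarrow> P (s + u)"
  proof (induction s rule: poly_mapping_additive_induct)
    case (single x n)
    show ?case
    proof (induction n)
      case (Suc n)
      have "Poly_Mapping.single x (Suc n) = pvar x + Poly_Mapping.single x n"
        by (simp add: pvar_def flip: single_add)
      then show ?case using Suc assms(2) by (simp add: add.assoc)
    qed simp
  qed (simp add: add.assoc)
  then show ?thesis using assms(1) by (metis add.right_neutral)
qed

definition term_eval :: "('x \<Rightarrow> 'b::comm_ring_1) \<Rightarrow> 'x pterm \<Rightarrow> 'b" where
  "term_eval \<Gamma> s = (\<Prod>x\<in>Poly_Mapping.keys s. \<Gamma> x ^ Poly_Mapping.lookup s x)"

lemma term_eval_0 [simp]: "term_eval \<Gamma> 0 = 1"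
  by (simp add: term_eval_def)

lemma term_eval_pvar [simp]: "term_eval \<Gamma> (pvar x) = \<Gamma> x"
  by (simp add: term_eval_def pvar_def)

lemma term_eval_add: "term_eval \<Gamma> (s + u) = term_eval \<Gamma> s * term_eval \<Gamma> u"
proof -
  let ?K = "Poly_Mapping.keys s \<union> Poly_Mapping.keys u"
  have *: "term_eval \<Gamma> v = (\<Prod>x\<in>?K. \<Gamma> x ^ Poly_Mapping.lookup v x)"
    if "Poly_Mapping.keys v \<subseteq> ?K" for v
    unfolding term_eval_def using that
    by (intro prod.mono_neutral_left) (auto simp: in_keys_iff)
  have "Poly_Mapping.keys (s + u) \<subseteq> ?K" by (rule keys_add)
  then show ?thesis by (simp add: * lookup_add power_add prod.distrib)
qed

lemma type_ring_hom:
  fixes \<phi> :: "'a::comm_ring_1 \<Rightarrow> 'b::comm_ring_1"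
  assumes "\<phi> \<in> ring_hom ring_of_type_algebra ring_of_type_algebra"
  shows "\<phi> (a + b) = \<phi> a + \<phi> b" "\<phi> (a * b) = \<phi> a * \<phi> b" "\<phi> 1 = 1" "\<phi> 0 = 0"
    "\<phi> (- a) = - \<phi> a" "\<phi> (a - b) = \<phi> a - \<phi> b"
    "\<phi> (sum f A) = (\<Sum>x\<in>A. \<phi> (f x))" "\<phi> (prod f A) = (\<Prod>x\<in>A. \<phi> (f x))"
proof -
  have add: "\<phi> (a + b) = \<phi> a + \<phi> b" and mult: "\<phi> (a * b) = \<phi> a * \<phi> b" and 1: "\<phi> 1 = 1" for a b
    using ring_hom_mult[OF assms, of a b] ring_hom_add[OF assms, of a b] ring_hom_one[OF assms]
    by (simp_all add: ring_of_type_algebra_def)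
  show "\<phi> (a + b) = \<phi> a + \<phi> b" "\<phi> (a * b) = \<phi> a * \<phi> b" "\<phi> 1 = 1" by (fact add mult 1)+
  show 0: "\<phi> 0 = 0" using add[of 0 0] by simp
  show minus: "\<phi> (- a) = - \<phi> a" for a using add[of a "- a"] 0 by (simp add: eq_neg_iff_add_eq_0 add.commute)
  show "\<phi> (a - b) = \<phi> a - \<phi> b" using add[of a "- b"] minus[of b] by simp
  show "\<phi> (sum f A) = (\<Sum>x\<in>A. \<phi> (f x))"
    by (induction A rule: infinite_finite_induct) (simp_all add: add 0)
  show "\<phi> (prod f A) = (\<Prod>x\<in>A. \<phi> (f x))"
    by (induction A rule: infinite_finite_induct) (simp_all add: mult 1)
qed

lemma type_ring_homI:
  fixes \<phi> :: "'a::comm_ring_1 \<Rightarrow> 'b::comm_ring_1"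
  assumes "\<And>a b. \<phi> (a + b) = \<phi> a + \<phi> b" "\<And>a b. \<phi> (a * b) = \<phi> a * \<phi> b" "\<phi> 1 = 1"
  shows "\<phi> \<in> ring_hom ring_of_type_algebra ring_of_type_algebra"
  using assms by (intro ring_hom_memI) (simp_all add: ring_of_type_algebra_def)

lemma meval_single:
  assumes "\<phi> 0 = 0"
  shows "meval \<phi> \<Gamma> (Poly_Mapping.single s a) = \<phi> a * term_eval \<Gamma> s"
  using assms by (simp add: meval_def term_eval_def)

lemma meval_ring_hom:
  fixes \<phi> :: "'a::comm_ring_1 \<Rightarrow> 'b::comm_ring_1"
  assumes \<phi>: "\<phi> \<in> ring_hom ring_of_type_algebra ring_of_type_algebra"
  shows "meval \<phi> \<Gamma> \<in> ring_hom ring_of_type_algebra ring_of_type_algebra"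
proof (rule type_ring_homI)
  note h = type_ring_hom[OF \<phi>]
  show add: "meval \<phi> \<Gamma> (f + g) = meval \<phi> \<Gamma> f + meval \<phi> \<Gamma> g" for f g
    unfolding meval_def
    by (rule setsum_keys_plus_distrib) (simp_all add: h algebra_simps)
  show "meval \<phi> \<Gamma> (f * g) = meval \<phi> \<Gamma> f * meval \<phi> \<Gamma> g" for f g
  proof (induction f rule: poly_mapping_additive_induct)
    case (single s a)
    show ?case
    proof (induction g rule: poly_mapping_additive_induct)
      case (single u b)
      show ?case by (simp add: mult_single meval_single h term_eval_add mult_ac)
    qed (simp add: distrib_left add)
  qed (simp add: distrib_right add)
  show "meval \<phi> \<Gamma> 1 = 1"
    using meval_single[where \<phi> = \<phi>, OF h(4), of \<Gamma> 0 1] by (simp add: h)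
qed

lemma mconst_ring_hom:
  "(mconst :: 'a::comm_ring_1 \<Rightarrow> ('x, 'a) mpoly) \<in> ring_hom ring_of_type_algebra ring_of_type_algebra"
  by (rule type_ring_homI) (simp_all add: mconst_def single_add mult_single)

lemma meval_mconst: "\<phi> 0 = 0 \<Longrightarrow> meval \<phi> \<Gamma> (mconst a) = \<phi> a"
  by (simp add: mconst_def meval_single)

lemma meval_mvar:
  fixes \<phi> :: "'a::comm_ring_1 \<Rightarrow> 'b::comm_ring_1"
  shows "\<phi> 0 = 0 \<Longrightarrow> \<phi> 1 = 1 \<Longrightarrow> meval \<phi> \<Gamma> (mvar x) = \<Gamma> x"
  by (simp add: mvar_def mmonom_def meval_single)

lemma type_ring_hom_comp:
  fixes f :: "'a::comm_ring_1 \<Rightarrow> 'b::comm_ring_1" and g :: "'b \<Rightarrow> 'c::comm_ring_1"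
  assumes "f \<in> ring_hom ring_of_type_algebra ring_of_type_algebra"
    "g \<in> ring_hom ring_of_type_algebra ring_of_type_algebra"
  shows "(\<lambda>x. g (f x)) \<in> ring_hom ring_of_type_algebra ring_of_type_algebra"
  by (rule type_ring_homI) (simp_all add: type_ring_hom[OF assms(1)] type_ring_hom[OF assms(2)])

text \<open>
  Applying a ring homomorphism to the coefficients is an evaluation in the polynomial ring over
  the target.  Hence it is a ring homomorphism and commutes with determinants.
\<close>

lemma lookup_meval_mconst_mvar:
  fixes \<psi> :: "'a::comm_ring_1 \<Rightarrow> 'b::comm_ring_1"
  assumes \<psi>: "\<psi> \<in> ring_hom ring_of_type_algebra ring_of_type_algebra"
  shows "Poly_Mapping.lookup (meval (\<lambda>a. mconst (\<psi> a)) mvar F) s = \<psi> (Poly_Mapping.lookup F s)"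
proof -
  have mono: "term_eval mvar u = (mmonom u :: ('c, 'b) mpoly)" for u :: "'c pterm"
  proof (induction u rule: pterm_induct)
    case (pvar r u)
    then show ?case by (simp add: term_eval_add mvar_def mmonom_def mult_single)
  qed (simp add: mmonom_def)
  show ?thesis
  proof (induction F rule: poly_mapping_additive_induct)
    case (single u a)
    have "\<psi> 0 = 0" by (rule type_ring_hom[OF \<psi>])
    then show ?case
      by (simp add: meval_single mconst_def mono)
        (simp add: mmonom_def mult_single lookup_single when_def)
  next
    case (add f g)
    then show ?case
      by (simp add: type_ring_hom[OF meval_ring_hom[OF type_ring_hom_comp[OF \<psi> mconst_ring_hom]]]
          lookup_add type_ring_hom[OF \<psi>])
  qed
qed

context
  fixes \<phi> :: "'a::comm_ring_1 \<Rightarrow> 'b::comm_ring_1"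
  assumes \<phi>: "\<phi> \<in> ring_hom ring_of_type_algebra ring_of_type_algebra"
begin

lemma map_matrix_det: "\<phi> (det A) = det (map_matrix \<phi> A)" for A :: "'a ^ 'd ^ 'd::finite"
proof -
  have "\<phi> (of_int (sign p)) = of_int (sign p)" for p :: "'d \<Rightarrow> 'd"
    by (cases p rule: sign_cases) (simp_all add: type_ring_hom[OF \<phi>])
  then show ?thesis by (simp add: det_def type_ring_hom[OF \<phi>])
qed

lemma map_matrix_mult: "map_matrix \<phi> (A ** B) = map_matrix \<phi> A ** map_matrix \<phi> B"
  by (simp add: vec_eq_iff matrix_matrix_mult_def type_ring_hom[OF \<phi>])

lemma map_matrix_mat_1: "map_matrix \<phi> (mat 1) = mat 1"
  by (simp add: vec_eq_iff mat_def type_ring_hom[OF \<phi>])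

lemma map_matrix_pterm_matrix_eval:
  fixes M :: "'n::{finite,linorder} \<Rightarrow> 'a ^ 'd ^ 'd::finite"
  shows "map_matrix \<phi> (pterm_matrix_eval M s) = pterm_matrix_eval (\<lambda>r. map_matrix \<phi> (M r)) s"
proof -
  have pow: "map_matrix \<phi> (matrix_power A k) = matrix_power (map_matrix \<phi> A) k" for A :: "'a^'d^'d" and k
    by (induction k) (simp_all add: matrix_power_def map_matrix_mult map_matrix_mat_1)
  have "map_matrix \<phi> (foldr (\<lambda>x N. matrix_power (M x) (Poly_Mapping.lookup s x) ** N) xs (mat 1)) =
    foldr (\<lambda>x N. matrix_power (map_matrix \<phi> (M x)) (Poly_Mapping.lookup s x) ** N) xs (mat 1)" for xs
    by (induction xs) (simp_all add: map_matrix_mult map_matrix_mat_1 pow)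
  then show ?thesis by (simp add: pterm_matrix_eval_def)
qed

end

section \<open>Modules given by commuting matrices\<close>

locale commuting_matrices =
  fixes M :: "'n::{finite,linorder} \<Rightarrow> 'a::comm_ring_1 ^ 'm ^ 'm::finite"
  assumes comm: "M r ** M s = M s ** M r"
begin

abbreviation E where "E \<equiv> pterm_matrix_eval M"

lemma E_0: "E 0 = mat 1"
proof -
  have "foldr (\<lambda>x N. matrix_power (M x) 0 ** N) xs (mat 1) = mat 1" for xs
    by (induction xs) (simp_all add: matrix_power_def)
  then show ?thesis by (simp add: pterm_matrix_eval_def)
qed

lemma matrix_power_comm: "M r ** matrix_power (M s) k = matrix_power (M s) k ** M r"
proof (induction k)
  case (Suc k)
  have "M r ** (M s ** matrix_power (M s) k) = M s ** (M r ** matrix_power (M s) k)"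
    by (simp add: matrix_mul_assoc comm)
  also have "\<dots> = (M s ** matrix_power (M s) k) ** M r" unfolding Suc by (simp add: matrix_mul_assoc)
  finally show ?case by (simp add: matrix_power_def)
qed (simp add: matrix_power_def)

text \<open>
  For commuting matrices the order of the factors does not matter, so evaluation at the matrices becomes
  multiplicative in the term.
\<close>

lemma E_pvar_add: "E (pvar r + s) = M r ** E s"
proof -
  let ?F = "\<lambda>s xs. foldr (\<lambda>x N. matrix_power (M x) (Poly_Mapping.lookup s x) ** N) xs (mat 1)"
  have lk: "Poly_Mapping.lookup (pvar r + s) x = (if x = r then Suc (Poly_Mapping.lookup s x)
      else Poly_Mapping.lookup s x)" for x
    by (simp add: lookup_add pvar_def lookup_single when_def)
  have "?F (pvar r + s) xs = (if r \<in> set xs then M r ** ?F s xs else ?F s xs)" if "distinct xs" for xs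
    using that
  proof (induction xs)
    case (Cons x xs)
    show ?case
    proof (cases "x = r")
      case True
      then show ?thesis using Cons by (simp add: lk matrix_power_def matrix_mul_assoc)
    next
      case False
      then show ?thesis using Cons by (simp add: lk matrix_mul_assoc matrix_power_comm)
    qed
  qed simp
  then show ?thesis by (simp add: pterm_matrix_eval_def)
qed

lemma E_pvar: "E (pvar r) = M r"
  using E_pvar_add[of r 0] by (simp add: E_0)

lemma E_add: "E (s + u) = E s ** E u"
  by (induction s rule: pterm_induct) (simp_all add: E_0 E_pvar_add matrix_mul_assoc add.assoc)

lemma E_transpose: "pterm_matrix_eval (\<lambda>r. transpose (M r)) s = transpose (E s)"
proof -
  interpret t: commuting_matrices "\<lambda>r. transpose (M r)"
    by standard (simp add: comm flip: matrix_transpose_mul)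
  show ?thesis
  proof (induction s rule: pterm_induct)
    case (pvar r s)
    have "E (pvar r + s) = E s ** M r" using E_add[of s "pvar r"] by (simp add: E_pvar add.commute)
    then show ?case using pvar by (simp add: t.E_pvar_add matrix_transpose_mul)
  qed (simp add: E_0 t.E_0)
qed

end

locale commuting_matrices_field = commuting_matrices M
  for M :: "'n::{finite,linorder} \<Rightarrow> 'l::field ^ 'm ^ 'm::finite"
begin

definition act :: "('n, 'l) mpoly \<Rightarrow> 'l ^ 'm \<Rightarrow> 'l ^ 'm" where
  "act f v = (\<Sum>s\<in>Poly_Mapping.keys f. Poly_Mapping.lookup f s *s (E s *v v))"

lemma act_single: "act (Poly_Mapping.single s a) v = a *s (E s *v v)"
  by (simp add: act_def)

lemma act_mmonom: "act (mmonom s) v = E s *v v"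
  by (simp add: mmonom_def act_single)

lemma act_mconst: "act (mconst a) v = a *s v"
  by (simp add: mconst_def act_single E_0)

lemma act_add: "act (f + g) v = act f v + act g v"
  unfolding act_def
  by (rule setsum_keys_plus_distrib) (simp_all add: vec.scale_left_distrib)

lemma linear_act: "Vector_Spaces.linear (*s) (*s) (act f)"
proof (induction f rule: poly_mapping_additive_induct)
  case (single s a)
  show ?case unfolding act_single[abs_def]
    by (rule vec.linear_compose_scale_right[OF matrix_vector_mul_linear_gen])
next
  case (add f g)
  then show ?case by (simp add: act_add[abs_def] vec.linear_compose_add)
qed

lemma act_mult: "act (f * g) v = act f (act g v)"
proof (induction f rule: poly_mapping_additive_induct)
  case (single s a)
  show ?case
  proof (induction g rule: poly_mapping_additive_induct)
    case (single u b)
    show ?case by (simp add: mult_single act_single E_add matrix_vector_mul_assoc vector_scalar_commute)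
  next
    case (add f g)
    have "act (Poly_Mapping.single s a) (act f v + act g v) =
      act (Poly_Mapping.single s a) (act f v) + act (Poly_Mapping.single s a) (act g v)"
      by (rule vec.linear_add[OF linear_act])
    then show ?case using add by (simp add: distrib_left act_add)
  qed
qed (simp add: distrib_right act_add)

end

section \<open>Adapted bases and zero blocks\<close>

lemma matrix_vector_mult_axis: "A *v axis k 1 = column k (A :: 'a::comm_semiring_1 ^ 'n ^ 'm)"
proof -
  have "(\<Sum>j\<in>UNIV. A $ i $ j * axis k 1 $ j) = (\<Sum>j\<in>UNIV. if j = k then A $ i $ j else 0)" for i
    by (intro sum.cong) (auto simp: axis_def)
  then show ?thesis by (simp add: matrix_vector_mult_def column_def vec_eq_iff)
qed

text \<open>
  By the pigeonhole principle every permutation picks an entry of the block of zeros.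
\<close>

lemma det_zero_block:
  fixes A :: "'a::comm_ring_1 ^ 'm ^ 'm::finite"
  assumes zero: "\<And>x y. x \<in> Rs \<Longrightarrow> y \<in> Cs \<Longrightarrow> A $ x $ y = 0" and card: "CARD('m) < card Rs + card Cs"
  shows "det A = 0"
proof -
  have "(\<Prod>i\<in>UNIV. A $ i $ p i) = 0" if p: "p permutes UNIV" for p
  proof -
    have "card (p ` Rs) = card Rs" by (intro card_image inj_on_subset[OF permutes_inj[OF p]]) simp
    have "p ` Rs \<inter> Cs \<noteq> {}"
    proof
      assume "p ` Rs \<inter> Cs = {}"
      then have "card (p ` Rs \<union> Cs) = card Rs + card Cs"
        using \<open>card (p ` Rs) = card Rs\<close> by (subst card_Un_disjoint) auto
      moreover have "card (p ` Rs \<union> Cs) \<le> CARD('m)" by (intro card_mono) auto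
      ultimately show False using card by simp
    qed
    then obtain x where "x \<in> Rs" "p x \<in> Cs" by blast
    then have "\<exists>i\<in>UNIV. A $ i $ p i = 0" using zero by blast
    then show ?thesis by (simp add: prod_zero)
  qed
  then show ?thesis by (simp add: det_def)
qed

lemma ex_matrix_with_columns_in_subspace:
  fixes S :: "('l::field ^ 'm::finite) set"
  assumes "vec.subspace S"
  shows "\<exists>(U :: 'l ^ 'm ^ 'm) Cs. det U \<noteq> 0 \<and> card Cs = vec.dim S \<and> (\<forall>y\<in>Cs. column y U \<in> S)"
proof -
  obtain B where B: "B \<subseteq> S" "vec.independent B" "S \<subseteq> vec.span B" "card B = vec.dim S"
    by (rule vec.basis_exists)
  let ?E = "vec.extend_basis B"
  note E = vec.extend_basis_superset[OF B(2)] vec.independent_extend_basis[OF B(2)]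
    vec.span_extend_basis[OF B(2)]
  have fin: "finite ?E" by (rule vec.finiteI_independent[OF E(2)])
  have "card ?E = CARD('m)"
    using vec.dim_eq_card[of ?E UNIV] E(2,3) vec_dim_card[where 'a = 'l and 'n = 'm] by simp
  then obtain h :: "'m \<Rightarrow> 'l ^ 'm" where h: "bij_betw h UNIV ?E"
    using fin by (metis bij_betw_iff_card finite_class.finite_UNIV)
  define U :: "'l ^ 'm ^ 'm" where "U = (\<chi> i j. h j $ i)"
  have col: "column j U = h j" for j by (simp add: U_def column_def vec_eq_iff)
  have "columns U = ?E" using h by (auto simp: columns_def col bij_betw_def)
  then have "vec.span (columns U) = UNIV" using E(3) by simp
  then have "det U \<noteq> 0"
    by (simp add: invertible_right_inverse matrix_right_invertible_span_columns flip: invertible_det_nz)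
  moreover have "card (h -` B) = vec.dim S"
  proof -
    have "h ` (h -` B) = B" using h E(1) by (auto simp: bij_betw_def)
    moreover have "inj_on h (h -` B)" using h by (auto simp: bij_betw_def inj_on_def)
    ultimately show ?thesis using B(4) by (metis card_image)
  qed
  moreover have "\<forall>y\<in>h -` B. column y U \<in> S" using B(1) by (auto simp: col)
  ultimately show ?thesis by blast
qed

text \<open>
  A basis of \<open>N\<close> is extended to a basis of the whole space, and the added vectors span \<open>T\<close>.
\<close>

lemma ex_complement:
  fixes N :: "('l::field ^ 'm::finite) set"
  assumes N: "vec.subspace N"
  shows "\<exists>T. vec.subspace T \<and> T \<inter> N = {0} \<and> vec.dim T + vec.dim N = CARD('m)"
proof -
  obtain B where B: "B \<subseteq> N" "vec.independent B" "N \<subseteq> vec.span B" "card B = vec.dim N"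
    by (rule vec.basis_exists)
  let ?E = "vec.extend_basis B"
  note E = vec.extend_basis_superset[OF B(2)] vec.independent_extend_basis[OF B(2)]
    vec.span_extend_basis[OF B(2)]
  have fin: "finite ?E" by (rule vec.finiteI_independent[OF E(2)])
  have cE: "card ?E = CARD('m)"
    using vec.dim_eq_card[of ?E UNIV] E(2,3) vec_dim_card[where 'a = 'l and 'n = 'm] by simp
  define T where "T = vec.span (?E - B)"
  have spB: "vec.span B = N" using B(1,3) N by (meson vec.span_minimal subset_antisym)
  have "vec.independent (?E - B)" using E(2) by (rule vec.independent_mono) blast
  then have "vec.dim T = card (?E - B)" unfolding T_def by (rule vec.dim_span_eq_card_independent)
  also have "\<dots> = card ?E - card B" using E(1) by (intro card_Diff_subset) (auto intro: finite_subset fin)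
  finally have dim: "vec.dim T + vec.dim N = CARD('m)"
    using cE B(4) card_mono[OF fin E(1)] by simp
  have sub: "vec.subspace T" by (simp add: T_def)
  have "{x + y |x y. x \<in> T \<and> y \<in> N} = vec.span ((?E - B) \<union> B)"
    unfolding vec.span_Un T_def spB by auto
  also have "(?E - B) \<union> B = ?E" using E(1) by blast
  finally have "{x + y |x y. x \<in> T \<and> y \<in> N} = UNIV" using E(3) by simp
  then have "vec.dim {x + y |x y. x \<in> T \<and> y \<in> N} = CARD('m)" by (simp only: vec_dim_card)
  then have "vec.dim (T \<inter> N) = 0"
    using vec.dim_sums_Int[OF sub N] dim by linarith
  then have "T \<inter> N = {0}"
    using vec.subspace_0[OF sub] vec.subspace_0[OF N] by (auto simp: vec.dim_eq_0)
  then show ?thesis using sub dim by blast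
qed

section \<open>Cyclic modules and the Gram matrix of a linear form\<close>

text \<open>
  The module over the polynomial ring given by the matrices is generated by \<open>e\<close>, and the terms \<open>t\<close> applied to
  \<open>e\<close> are the standard basis.  So \<open>\<pi>\<close> is the projection of the polynomial ring onto its quotient by \<open>I\<close>, written in
  coordinates with respect to \<open>t\<close>.
\<close>

locale cyclic_quotient = commuting_matrices_field M
  for M :: "'n::{finite,linorder} \<Rightarrow> 'l::field ^ 'm ^ 'm::finite" +
  fixes t :: "'m \<Rightarrow> 'n pterm" and e :: "'l ^ 'm"
  assumes basis: "E (t j) *v e = axis j 1"
begin

definition \<pi> :: "('n, 'l) mpoly \<Rightarrow> 'l ^ 'm" where "\<pi> f = act f e"

definition I :: "('n, 'l) mpoly set" where "I = {f. \<pi> f = 0}"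

definition combination :: "'l ^ 'm \<Rightarrow> ('n, 'l) mpoly" where
  "combination v = (\<Sum>i\<in>UNIV. mconst (v $ i) * mmonom (t i))"

lemma act_0: "act 0 v = 0"
  by (simp add: act_def)

lemma act_sum: "act (sum f A) v = (\<Sum>x\<in>A. act (f x) v)"
  by (induction A rule: infinite_finite_induct) (simp_all add: act_0 act_add)

lemma act_diff: "act (f - g) v = act f v - act g v"
  using act_add[of "f - g" g v] by simp

lemma \<pi>_simps: "\<pi> (f + g) = \<pi> f + \<pi> g" "\<pi> (f - g) = \<pi> f - \<pi> g" "\<pi> 0 = 0"
    "\<pi> (f * g) = act f (\<pi> g)" "\<pi> (mconst c * f) = c *s \<pi> f"
  by (simp_all add: \<pi>_def act_add act_diff act_0 act_mult act_mconst)

lemma act_combination: "act (combination v) w = (\<Sum>i\<in>UNIV. v $ i *s (E (t i) *v w))"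
  by (simp add: combination_def act_sum act_mult act_mconst act_mmonom)

lemma \<pi>_combination [simp]: "\<pi> (combination v) = v"
  by (simp add: \<pi>_def act_combination basis basis_expansion)

lemma ideal_I: "ideal I ring_of_type_algebra"
  unfolding ideal_ring_of_type_algebra_iff I_def
  using vec.linear_0[OF linear_act] by (auto simp: \<pi>_simps)

lemma subspace_\<pi>_ideal:
  assumes "ideal J ring_of_type_algebra"
  shows "vec.subspace (\<pi> ` J)"
proof (rule vec.subspaceI)
  note cl = ideal_closed[OF assms]
  show "0 \<in> \<pi> ` J" using cl(1) \<pi>_simps(3) by (metis imageI)
  show "x + y \<in> \<pi> ` J" if xy: "x \<in> \<pi> ` J" "y \<in> \<pi> ` J" for x y
  proof -
    obtain f g where "f \<in> J" "g \<in> J" "x = \<pi> f" "y = \<pi> g" using xy by blast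
    then show ?thesis using cl(2)[of f g] \<pi>_simps(1)[of f g] by (metis imageI)
  qed
  show "c *s x \<in> \<pi> ` J" if x: "x \<in> \<pi> ` J" for c x
  proof -
    obtain f where "f \<in> J" "x = \<pi> f" using x by blast
    then show ?thesis using cl(3)[of f "mconst c"] \<pi>_simps(5)[of c f] by (metis imageI)
  qed
qed

lemma \<pi>_mem_image_iff:
  assumes "ideal J ring_of_type_algebra" "I \<subseteq> J"
  shows "\<pi> f \<in> \<pi> ` J \<longleftrightarrow> f \<in> J"
proof
  assume "\<pi> f \<in> \<pi> ` J"
  then obtain g where g: "g \<in> J" "\<pi> f = \<pi> g" by blast
  then have "f - g \<in> J" using assms(2) by (auto simp: I_def \<pi>_simps)
  then show "f \<in> J" using ideal_closed(2)[OF assms(1) _ g(1), of "f - g"] by simp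
qed simp

sublocale artinian_quotient I
proof (rule artinian_quotient.intro)
  show "ideal I ring_of_type_algebra" by (rule ideal_I)
  fix S :: "('n, 'l) mpoly set set"
  assume S: "S \<noteq> {}" and id: "\<And>J. J \<in> S \<Longrightarrow> ideal J ring_of_type_algebra \<and> I \<subseteq> J"
  \<comment> \<open>Ideals above \<open>I\<close> correspond to subspaces of a finite-dimensional space.\<close>
  obtain J where J: "J \<in> S" and min: "\<And>J'. J' \<in> S \<Longrightarrow> vec.dim (\<pi> ` J) \<le> vec.dim (\<pi> ` J')"
    using ex_has_least_nat[of "\<lambda>J. J \<in> S" _ "\<lambda>J. vec.dim (\<pi> ` J)"] S by blast
  have "J' = J" if J': "J' \<in> S" "J' \<subseteq> J" for J'
  proof -
    have "vec.span (\<pi> ` J') = vec.span (\<pi> ` J)"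
      by (rule vec.dim_eq_span[OF image_mono[OF J'(2)] min[OF J'(1)]])
    then have "\<pi> ` J' = \<pi> ` J"
      using subspace_\<pi>_ideal[of J] subspace_\<pi>_ideal[of J'] id[OF J] id[OF J'(1)]
      by (simp add: vec.span_eq_iff[THEN iffD2])
    then have "J \<subseteq> J'" using \<pi>_mem_image_iff[of J'] id[OF J'(1)] by blast
    then show ?thesis using J'(2) by blast
  qed
  then show "\<exists>J\<in>S. \<forall>J'\<in>S. J' \<subseteq> J \<longrightarrow> J' = J" using J by blast
qed

lemma act_eq_0_iff_product: "act f (\<pi> g) = 0 \<longleftrightarrow> f * g \<in> I"
  by (simp add: I_def \<pi>_simps)

subsection \<open>Cyclic socles give a nondegenerate form\<close>

text \<open>
  Socle elements of different maximal ideals are linearly independent: a linear relation is multiplied by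
  an \<open>f\<close> that lies in all of the maximal ideals except \<open>N\<close>, which leaves only the term of \<open>N\<close>, and \<open>f\<close> does not kill the
  socle element of \<open>N\<close>.  Hence a linear form can take prescribed values on them.
\<close>

lemma ex_dual_socle_functional:
  fixes s :: "('n, 'l) mpoly set \<Rightarrow> ('n, 'l) mpoly"
  assumes s: "\<And>N. maximalideal N R \<Longrightarrow> I \<subseteq> N \<Longrightarrow> s N \<notin> I \<and> (\<forall>m\<in>N. m * s N \<in> I)"
  shows "\<exists>c::'l ^ 'm. \<forall>N. maximalideal N R \<and> I \<subseteq> N \<longrightarrow> (\<Sum>q\<in>UNIV. c $ q * \<pi> (s N) $ q) = 1"
proof -
  let ?X = "{N. maximalideal N R \<and> I \<subseteq> N}"
  let ?B = "(\<lambda>N. \<pi> (s N)) ` ?X"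
  have "vec.independent ?B"
  proof (rule vec.independent_if_scalars_zero)
    show fin: "finite ?B" using finite_maximalideals by simp
    fix a w assume sum: "(\<Sum>w\<in>?B. a w *s w) = 0" and w: "w \<in> ?B"
    then obtain N where N: "maximalideal N R" "I \<subseteq> N" "w = \<pi> (s N)" by blast
    have "\<not> \<Inter>(?X - {N}) \<subseteq> N"
    proof
      assume sub: "\<Inter>(?X - {N}) \<subseteq> N"
      have "\<exists>J\<in>?X - {N}. J \<subseteq> N"
        by (rule Inter_subset_maximalideal[OF N(1) _ sub])
          (use finite_maximalideals in \<open>auto dest: maximalideal.axioms(1)\<close>)
      then obtain J where J: "J \<in> ?X - {N}" "J \<subseteq> N" by blast
      then have "J = N" using maximalideal_eqI[of J N] N(1) by simp
      then show False using J(1) by simp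
    qed
    then obtain f where f: "f \<in> \<Inter>(?X - {N})" "f \<notin> N" by blast
    have "act f w' = 0" if w': "w' \<in> ?B - {w}" for w'
    proof -
      obtain N' where N': "N' \<in> ?X" "w' = \<pi> (s N')" using w' by blast
      then have "N' \<in> ?X - {N}" using w' N(3) by blast
      then have "f * s N' \<in> I" using f(1) s[of N'] N'(1) by blast
      then show ?thesis using N'(2) act_eq_0_iff_product by simp
    qed
    then have zero: "(\<Sum>w'\<in>?B - {w}. a w' *s act f w') = 0" by (intro sum.neutral) simp
    have "0 = act f (\<Sum>w\<in>?B. a w *s w)" unfolding sum by (rule vec.linear_0[OF linear_act, symmetric])
    also have "\<dots> = (\<Sum>w\<in>?B. a w *s act f w)"
      by (simp add: vec.linear_sum[OF linear_act] vec.linear_scale[OF linear_act])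
    also have "\<dots> = a w *s act f w"
      using zero by (subst sum.remove[OF fin w]) simp
    finally have "a w *s act f w = 0" by simp
    moreover have "act f w \<noteq> 0"
    proof
      assume "act f w = 0"
      then have "f * s N \<in> I" using N(3) act_eq_0_iff_product by simp
      then show False using socle_annihilator[OF ideal_I N(1), of "s N" f] s[OF N(1,2)] f(2) by blast
    qed
    ultimately show "a w = 0" by simp
  qed
  then obtain g :: "'l ^ 'm \<Rightarrow> 'l ^ 1" where g: "Vector_Spaces.linear (*s) (*s) g" "\<And>w. w \<in> ?B \<Longrightarrow> g w = 1"
    using vec.linear_independent_extend[of ?B "\<lambda>_. 1"] by blast
  define c :: "'l ^ 'm" where "c = (\<chi> q. matrix g $ 1 $ q)"
  have "(\<Sum>q\<in>UNIV. c $ q * w $ q) = 1" if "w \<in> ?B" for w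
  proof -
    have "(\<Sum>q\<in>UNIV. c $ q * w $ q) = (matrix g *v w) $ 1"
      by (simp add: matrix_vector_mult_def c_def)
    also have "matrix g *v w = 1" using matrix_works[OF g(1)] g(2)[OF that] by simp
    finally show ?thesis by simp
  qed
  then show ?thesis by blast
qed

text \<open>
  Let \<open>L\<close> be the linear form with the value 1 on a socle generator for each maximal ideal.  A vector \<open>u\<close> in
  the kernel of its Gram matrix is an \<open>f\<close> such that \<open>L\<close> vanishes on the ideal \<open>(f)\<close>.  If \<open>f\<close> is not 0, this ideal
  contains a nonzero socle element and, since the socles are cyclic, also the chosen generator.
\<close>

lemma cyclic_socles_imp_nondegenerate:
  assumes "cyclic_socles I"
  shows "\<exists>c::'l ^ 'm. det (\<chi> k i. \<Sum>q\<in>UNIV. E (t i) $ q $ k * c $ q) \<noteq> 0"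
proof -
  obtain s where s: "\<And>N. maximalideal N R \<Longrightarrow> I \<subseteq> N \<Longrightarrow> s N \<notin> I \<and> (\<forall>m\<in>N. m * s N \<in> I)"
    using ex_socle_element by metis
  obtain c :: "'l ^ 'm" where
    c: "\<And>N. maximalideal N R \<Longrightarrow> I \<subseteq> N \<Longrightarrow> (\<Sum>q\<in>UNIV. c $ q * \<pi> (s N) $ q) = 1"
    using ex_dual_socle_functional[OF s] by blast
  define L where "L v = (\<Sum>q\<in>UNIV. c $ q * v $ q)" for v :: "'l ^ 'm"
  have L_sum: "L (\<Sum>x\<in>A. a x *s v x) = (\<Sum>x\<in>A. a x * L (v x))" for a v and A :: "'m set"
    unfolding L_def by (simp add: sum_distrib_left mult_ac) (rule sum.swap)
  let ?D = "\<chi> k i. \<Sum>q\<in>UNIV. E (t i) $ q $ k * c $ q"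
  have "u = 0" if u: "?D *v u = 0" for u
  proof (rule ccontr)
    assume "u \<noteq> 0"
    let ?f = "combination u"
    have "?D $ k $ i = L (E (t i) *v axis k 1)" for k i
      by (simp add: L_def matrix_vector_mult_axis column_def mult.commute)
    then have "(?D *v u) $ k = L (act ?f (axis k 1))" for k
      by (simp add: act_combination L_sum matrix_vector_mult_def mult.commute)
    then have zero: "L (act ?f (axis k 1)) = 0" for k using u by simp
    have expand: "act ?f v = (\<Sum>k\<in>UNIV. v $ k *s act ?f (axis k 1))" for v
    proof -
      have "act ?f v = act ?f (\<Sum>k\<in>UNIV. v $ k *s axis k 1)" by (simp add: basis_expansion)
      then show ?thesis by (simp add: vec.linear_sum[OF linear_act] vec.linear_scale[OF linear_act])
    qed
    have L0: "L (act ?f v) = 0" for v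
      using arg_cong[OF expand[of v], of L] by (simp only: L_sum zero) simp
    have "?f \<notin> I" using \<open>u \<noteq> 0\<close> by (simp add: I_def)
    then obtain h where h: "?f * h \<notin> I" "maximalideal {x. x * (?f * h) \<in> I} R"
      by (rule ex_socle_multiple)
    let ?N = "{x. x * (?f * h) \<in> I}"
    have IN: "I \<subseteq> ?N" using cl by blast
    have "\<exists>x. s ?N - x * (?f * h) \<in> I"
      using assms[unfolded cyclic_socles_def, rule_format, OF h(2), of "s ?N" "?f * h"] s[OF h(2) IN] h(1)
      by blast
    then obtain x where "s ?N - x * (?f * h) \<in> I" by blast
    then have "\<pi> (s ?N) = \<pi> (x * (?f * h))" by (simp add: I_def \<pi>_simps)
    also have "x * (?f * h) = ?f * (x * h)" by (simp add: mult_ac)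
    finally have "L (\<pi> (s ?N)) = 0" using L0 by (simp add: \<pi>_simps)
    then show False using c[OF h(2) IN] by (simp add: L_def)
  qed
  then have "inj ((*v) ?D)"
    using vec.linear_inj_iff_eq_0[OF matrix_vector_mul_linear_gen] by blast
  then have "det ?D \<noteq> 0"
    by (simp add: invertible_left_inverse matrix_left_invertible_injective flip: invertible_det_nz)
  then show ?thesis by blast
qed

subsection \<open>A socle that is not cyclic gives a zero block\<close>

text \<open>
  Two independent elements \<open>a\<close>, \<open>b\<close> of the socle at \<open>N\<close> generate two copies of the residue field, with trivial
  intersection.  With a complement \<open>T\<close> of the image of \<open>N\<close>, multiplication by \<open>a\<close> and by \<open>b\<close> is injective on \<open>T\<close>, so
  they generate a space \<open>S\<close> of twice the dimension of \<open>T\<close>.  Since the product of \<open>N\<close> and \<open>S\<close> is 0, bases adapted to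
  \<open>N\<close> and \<open>S\<close> give the block.
\<close>

lemma not_cyclic_socles_imp_zero_block:
  assumes "\<not> cyclic_socles I"
  obtains U W :: "'l ^ 'm ^ 'm" and Rs Cs where "det U \<noteq> 0" "det W \<noteq> 0" "CARD('m) < card Rs + card Cs"
    "\<And>x y. x \<in> Rs \<Longrightarrow> y \<in> Cs \<Longrightarrow> (\<Sum>i\<in>UNIV. column y U $ i *s (E (t i) *v column x W)) = 0"
proof -
  obtain N a b where N: "maximalideal N R" and a: "\<forall>m\<in>N. m * a \<in> I" and b: "\<forall>m\<in>N. m * b \<in> I" "b \<notin> I"
    and ab: "\<And>c. a - c * b \<notin> I"
    using assms unfolding cyclic_socles_def by blast
  have "a \<notin> I" using ab[of 0] by simp
  have idN: "ideal N R" using N by (rule maximalideal.axioms)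
  note clN = ideal_closed[OF idN]
  have ann_a: "f * a \<in> I \<longleftrightarrow> f \<in> N" and ann_b: "f * b \<in> I \<longleftrightarrow> f \<in> N" for f
    using socle_annihilator[OF ideal_I N] a b \<open>a \<notin> I\<close> by blast+
  have IN: "I \<subseteq> N" using ann_a cl(4) by blast
  have rel: "f \<in> N \<and> g \<in> N" if fg: "a * f - b * g \<in> I" for f g
  proof -
    have f: "f \<in> N"
    proof (rule ccontr)
      assume "f \<notin> N"
      then obtain y where "1 - f * y \<in> N" by (rule maximalideal_inverse[OF N])
      then have "(1 - f * y) * a \<in> I" using a by blast
      then have "(1 - f * y) * a + (a * f - b * g) * y \<in> I" by (rule cl(2)[OF _ cl(4)[OF fg]])
      then show False using ab[of "g * y"] by (simp add: algebra_simps)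
    qed
    then have "a * f \<in> I" using ann_a[of f] by (simp add: mult.commute[of a])
    then have "a * f - (a * f - b * g) \<in> I" using fg by (rule cl(5))
    then show ?thesis using f ann_b[of g] by (simp add: mult.commute[of b])
  qed
  let ?N = "\<pi> ` N"
  have subN: "vec.subspace ?N" by (rule subspace_\<pi>_ideal[OF idN])
  obtain T where T: "vec.subspace T" "T \<inter> ?N = {0}" "vec.dim T + vec.dim ?N = CARD('m)"
    using ex_complement[OF subN] by blast
  have memN: "v \<in> ?N \<longleftrightarrow> combination v \<in> N" for v
    using \<pi>_mem_image_iff[OF idN IN, of "combination v"] by simp
  have relT: "v = 0 \<and> w = 0" if v: "v \<in> T" and w: "w \<in> T" and eq: "act a v = act b w" for v w
  proof -
    have "\<pi> (a * combination v - b * combination w) = 0" using eq by (simp add: \<pi>_simps)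
    then have "combination v \<in> N \<and> combination w \<in> N" by (intro rel) (simp add: I_def)
    then show ?thesis using memN T(2) v w by blast
  qed
  have act0: "act f 0 = 0" for f by (rule vec.linear_0[OF linear_act])
  have T0: "0 \<in> T" by (rule vec.subspace_0[OF T(1)])
  have inj: "inj_on (act a) (vec.span T)" "inj_on (act b) (vec.span T)"
  proof -
    have "v = w" if "v \<in> T" "w \<in> T" "act a v = act a w" for v w
      using relT[of "v - w" 0] that T0 vec.subspace_diff[OF T(1)] act0
      by (simp add: vec.linear_diff[OF linear_act])
    moreover have "v = w" if "v \<in> T" "w \<in> T" "act b v = act b w" for v w
      using relT[of 0 "v - w"] that T0 vec.subspace_diff[OF T(1)] act0
      by (simp add: vec.linear_diff[OF linear_act])
    ultimately show "inj_on (act a) (vec.span T)" "inj_on (act b) (vec.span T)"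
      using T(1) by (auto simp: inj_on_def vec.span_eq_iff[THEN iffD2])
  qed
  have subs: "vec.subspace (act a ` T)" "vec.subspace (act b ` T)"
    by (rule vec.linear_subspace_image[OF linear_act T(1)])+
  define S where "S = {x + y |x y. x \<in> act a ` T \<and> y \<in> act b ` T}"
  have "act a ` T \<inter> act b ` T = {0}"
  proof
    show "act a ` T \<inter> act b ` T \<subseteq> {0}"
    proof
      fix x assume "x \<in> act a ` T \<inter> act b ` T"
      then obtain v w where vw: "v \<in> T" "w \<in> T" "x = act a v" "x = act b w" by blast
      then have "v = 0" using relT[of v w] by simp
      then show "x \<in> {0}" using vw(3) act0 by simp
    qed
    have "act a 0 \<in> act a ` T" "act b 0 \<in> act b ` T" using T0 by blast+
    then show "{0} \<subseteq> act a ` T \<inter> act b ` T" unfolding act0 by blast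
  qed
  then have dimS: "vec.dim S = 2 * vec.dim T"
    using vec.dim_sums_Int[OF subs] vec.dim_image_eq[OF linear_act inj(1)]
      vec.dim_image_eq[OF linear_act inj(2)] unfolding S_def by simp
  have subS: "vec.subspace S" unfolding S_def by (rule vec.subspace_sums[OF subs])
  have "vec.dim T \<noteq> 0"
  proof
    assume "vec.dim T = 0"
    then have "vec.dim (UNIV :: ('l ^ 'm) set) \<le> vec.dim ?N" using T(3) by (simp only: vec_dim_card)
    from vec.dim_eq_span[OF subset_UNIV this] have "?N = UNIV"
      using subN by (simp only: vec.span_eq_iff[THEN iffD2] vec.span_UNIV)
    then have "\<pi> 1 \<in> ?N" by simp
    then have "1 \<in> N" using \<pi>_mem_image_iff[OF idN IN] by blast
    then show False using N by (simp add: maximalideal_ring_of_type_algebra_iff)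
  qed
  obtain U :: "'l ^ 'm ^ 'm" and Cs where U: "det U \<noteq> 0" "card Cs = vec.dim S" "\<forall>y\<in>Cs. column y U \<in> S"
    using ex_matrix_with_columns_in_subspace[OF subS] by blast
  obtain W :: "'l ^ 'm ^ 'm" and Rs where W: "det W \<noteq> 0" "card Rs = vec.dim ?N" "\<forall>x\<in>Rs. column x W \<in> ?N"
    using ex_matrix_with_columns_in_subspace[OF subN] by blast
  have "CARD('m) < card Rs + card Cs" using U(2) W(2) T(3) dimS \<open>vec.dim T \<noteq> 0\<close> by linarith
  moreover have "(\<Sum>i\<in>UNIV. column y U $ i *s (E (t i) *v column x W)) = 0" if xy: "x \<in> Rs" "y \<in> Cs" for x y
  proof -
    obtain m where m: "m \<in> N" "column x W = \<pi> m" using W(3) xy by blast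
    obtain v w where vw: "column y U = act a v + act b w" using U(3) xy unfolding S_def by blast
    let ?f = "combination (column y U)"
    have "(\<Sum>i\<in>UNIV. column y U $ i *s (E (t i) *v column x W)) = act ?f (\<pi> m)"
      by (simp add: act_combination m(2))
    also have "\<dots> = \<pi> (m * ?f)" by (simp add: mult.commute flip: \<pi>_simps(4))
    also have "\<dots> = \<pi> (m * (a * combination v + b * combination w))" by (simp add: \<pi>_simps vw)
    also have "\<dots> = 0"
    proof -
      have "m * a \<in> I" "m * b \<in> I" using m(1) a b(1) by blast+
      then have "m * a * combination v + m * b * combination w \<in> I" by (intro cl(2) cl(4)[of "m * _"])
      then show ?thesis by (simp add: I_def distrib_left mult.assoc)
    qed
    finally show ?thesis .
  qed
  ultimately show ?thesis using that U W by blast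
qed

text \<open>
  The base changes have entries in the field, so their determinants are units in the polynomial ring; no
  values are substituted for the indeterminates, as a nonzero polynomial over a finite field may vanish everywhere.
\<close>

lemma not_cyclic_socles_imp_det_0:
  assumes "\<not> cyclic_socles I"
  shows "det (\<chi> k i. \<Sum>q\<in>UNIV. (mconst (E (t i) $ q $ k) * mvar q :: ('m, 'l) mpoly)) = 0"
proof -
  obtain U W :: "'l ^ 'm ^ 'm" and Rs Cs where UW: "det U \<noteq> 0" "det W \<noteq> 0" and card: "CARD('m) < card Rs + card Cs"
    and zero: "\<And>x y. x \<in> Rs \<Longrightarrow> y \<in> Cs \<Longrightarrow> (\<Sum>i\<in>UNIV. column y U $ i *s (E (t i) *v column x W)) = 0"
    by (rule not_cyclic_socles_imp_zero_block[OF assms]) blast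
  let ?c = "mconst :: 'l \<Rightarrow> ('m, 'l) mpoly"
  note c = type_ring_hom[OF mconst_ring_hom]
  define G where "G = (\<chi> k i. \<Sum>q\<in>UNIV. ?c (E (t i) $ q $ k) * mvar q)"
  let ?H = "transpose (map_matrix ?c W) ** G ** map_matrix ?c U"
  have H: "?H $ x $ y = (\<Sum>q\<in>UNIV. ?c ((\<Sum>i\<in>UNIV. column y U $ i *s (E (t i) *v column x W)) $ q) * mvar q)" for x y
  proof -
    have "?H $ x $ y = (\<Sum>i\<in>UNIV. \<Sum>k\<in>UNIV. \<Sum>q\<in>UNIV.
        ?c (W $ k $ x) * (?c (E (t i) $ q $ k) * mvar q) * ?c (U $ i $ y))"
      by (simp add: matrix_matrix_mult_def transpose_def G_def sum_distrib_left sum_distrib_right)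
    also have "\<dots> = (\<Sum>i\<in>UNIV. \<Sum>q\<in>UNIV. \<Sum>k\<in>UNIV.
        ?c (W $ k $ x) * (?c (E (t i) $ q $ k) * mvar q) * ?c (U $ i $ y))"
      by (intro sum.cong refl sum.swap)
    also have "\<dots> = (\<Sum>q\<in>UNIV. \<Sum>i\<in>UNIV. \<Sum>k\<in>UNIV.
        ?c (W $ k $ x) * (?c (E (t i) $ q $ k) * mvar q) * ?c (U $ i $ y))"
      by (rule sum.swap)
    also have "\<dots> = (\<Sum>q\<in>UNIV. ?c ((\<Sum>i\<in>UNIV. column y U $ i *s (E (t i) *v column x W)) $ q) * mvar q)"
      by (simp add: c column_def matrix_vector_mult_def sum_distrib_left sum_distrib_right mult_ac)
    finally show ?thesis .
  qed
  have "det ?H = 0"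
  proof (rule det_zero_block[OF _ card])
    fix x y assume "x \<in> Rs" "y \<in> Cs"
    then show "?H $ x $ y = 0" unfolding H zero[OF \<open>x \<in> Rs\<close> \<open>y \<in> Cs\<close>] by (simp add: c)
  qed
  then have "?c (det W) * det G * ?c (det U) = 0"
    by (simp add: det_mul det_transpose map_matrix_det[OF mconst_ring_hom])
  moreover have "?c (1 / det W) * ?c (det W) = 1" "?c (det U) * ?c (1 / det U) = 1"
    using UW by (simp_all add: c(3) flip: c(2))
  ultimately have "det G = (?c (1 / det W) * ?c (det W)) * det G * (?c (det U) * ?c (1 / det U))"
    by simp
  also have "\<dots> = ?c (1 / det W) * (?c (det W) * det G * ?c (det U)) * ?c (1 / det U)"
    by (simp only: mult_ac)
  also have "\<dots> = 0" using \<open>?c (det W) * det G * ?c (det U) = 0\<close> by simp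
  finally have "det G = 0" .
  then show ?thesis by (simp add: G_def)
qed

end

section \<open>Points of the border basis scheme\<close>

text \<open>
  The generic multiplication matrices with the coordinates of a point in place of the indeterminates.
\<close>

definition point_mult_matrix ::
  "('m::finite \<Rightarrow> 'n pterm) \<Rightarrow> ('v \<Rightarrow> 'n pterm) \<Rightarrow> ('m \<times> 'v \<Rightarrow> 'l::field) \<Rightarrow> 'n \<Rightarrow> 'l ^ 'm ^ 'm" where
  "point_mult_matrix t b \<Gamma> r = (\<chi> i j.
     if pvar r + t j \<in> range t
     then (if i = inv_into UNIV t (pvar r + t j) then 1 else 0)
     else \<Gamma> (i, inv_into UNIV b (pvar r + t j)))"

lemma map_generic_mult_matrix:
  fixes \<phi> :: "'k::field \<Rightarrow> 'l::field"
  assumes "\<phi> \<in> ring_hom ring_of_type_algebra ring_of_type_algebra"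
  shows "map_matrix (meval \<phi> \<Gamma>) (generic_mult_matrix t b r) = point_mult_matrix t b \<Gamma> r"
  by (simp add: vec_eq_iff generic_mult_matrix_def point_mult_matrix_def meval_mvar type_ring_hom[OF assms]
      type_ring_hom[OF meval_ring_hom[OF assms]])

lemma Idl_subset_iff:
  fixes J :: "'p::comm_ring_1 set"
  assumes "ideal J ring_of_type_algebra"
  shows "Idl\<^bsub>ring_of_type_algebra\<^esub> S \<subseteq> J \<longleftrightarrow> S \<subseteq> J"
proof -
  interpret cring "ring_of_type_algebra :: 'p ring" by (rule cring_from_type_algebra)
  show ?thesis using genideal_self[of S] genideal_minimal[OF assms, of S] by auto
qed

lemma ideal_Idl: "ideal (Idl\<^bsub>ring_of_type_algebra\<^esub> S) (ring_of_type_algebra :: 'p::comm_ring_1 ring)"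
proof -
  interpret cring "ring_of_type_algebra :: 'p ring" by (rule cring_from_type_algebra)
  show ?thesis by (rule genideal_ideal) simp
qed

locale border_point =
  fixes t :: "'m::finite \<Rightarrow> 'n::{finite,linorder} pterm"
    and b :: "'v::finite \<Rightarrow> 'n pterm"
    and \<Gamma> :: "'m \<times> 'v \<Rightarrow> 'l::field"
  assumes order_ideal: "order_ideal (range t)" and inj: "inj t"
    and border: "bij_betw b UNIV (border (range t))"
    and commute: "point_mult_matrix t b \<Gamma> r ** point_mult_matrix t b \<Gamma> s =
      point_mult_matrix t b \<Gamma> s ** point_mult_matrix t b \<Gamma> r"
begin

abbreviation A where "A \<equiv> point_mult_matrix t b \<Gamma>"

abbreviation unit_vector :: "'l ^ 'm" where "unit_vector \<equiv> axis (inv_into UNIV t 0) 1"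

sublocale commuting_matrices_field A
  by standard (rule commute)

lemma zero_in_range: "0 \<in> range t"
proof -
  obtain i :: 'm where True by blast
  have "0 + t i \<in> range t" by simp
  then show ?thesis using order_ideal unfolding order_ideal_def by blast
qed

lemma inv_t [simp]: "inv_into UNIV t (t j) = j"
  using inj by simp

lemma inv_b [simp]: "inv_into UNIV b (b j) = j"
  using border by (simp add: bij_betw_def)

lemma b_in_border: "b j \<in> border (range t)"
  using bij_betw_imp_surj_on[OF border] by blast

lemma A_axis:
  "pvar r + t j = t i \<Longrightarrow> A r *v axis j 1 = axis i 1"
  "pvar r + t j = b k \<Longrightarrow> A r *v axis j 1 = (\<chi> i. \<Gamma> (i, k))"
proof -
  assume "pvar r + t j = t i"
  then show "A r *v axis j 1 = axis i 1"
    unfolding matrix_vector_mult_axis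
    by (simp add: column_def vec_eq_iff point_mult_matrix_def axis_def)
next
  assume eq: "pvar r + t j = b k"
  have "b k \<notin> range t" using b_in_border[of k] by (simp add: border_def)
  then show "A r *v axis j 1 = (\<chi> i. \<Gamma> (i, k))"
    unfolding matrix_vector_mult_axis
    by (simp add: column_def vec_eq_iff point_mult_matrix_def eq)
qed

text \<open>
  A divisor of an element of the order ideal is again in the order ideal, so the terms on the way from \<open>1\<close> to
  \<open>t j\<close> all stay in the range where the matrices send basis vectors to basis vectors.
\<close>

lemma E_t: "E (t j) *v unit_vector = axis j 1"
proof -
  have "\<forall>j. s = t j \<longrightarrow> E s *v unit_vector = axis j 1" for s
  proof (induction s rule: pterm_induct)
    case zero
    show ?case using inv_t by (metis E_0 matrix_vector_mul_lid)
  next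
    case (pvar r s)
    show ?case
    proof (intro allI impI)
      fix j assume j: "pvar r + s = t j"
      then have "s + pvar r \<in> range t" by (simp add: add.commute)
      then obtain k where k: "s = t k" using order_ideal unfolding order_ideal_def by blast
      then have "E s *v unit_vector = axis k 1" using pvar by blast
      moreover have "A r *v axis k 1 = axis j 1" using j k by (intro A_axis(1)) simp
      ultimately show "E (pvar r + s) *v unit_vector = axis j 1"
        by (simp only: E_pvar_add flip: matrix_vector_mul_assoc)
    qed
  qed
  then show ?thesis by simp
qed

sublocale cyclic_quotient A t unit_vector
  by standard (rule E_t)

lemma b_decomposition: obtains r k where "b j = pvar r + t k"
proof -
  show ?thesis using b_in_border[of j] that by (auto simp: border_def)
qed

lemma \<pi>_b: "\<pi> (mmonom (b j)) = (\<chi> i. \<Gamma> (i, j))"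
proof -
  obtain r k where rk: "b j = pvar r + t k" by (rule b_decomposition)
  have "\<pi> (mmonom (b j)) = E (b j) *v unit_vector" by (simp add: \<pi>_def act_mmonom)
  also have "\<dots> = A r *v axis k 1" by (simp add: rk E_pvar_add E_t flip: matrix_vector_mul_assoc)
  also have "\<dots> = (\<chi> i. \<Gamma> (i, j))" using rk by (intro A_axis(2)) simp
  finally show ?thesis .
qed

lemma combination_add: "combination (v + w) = combination v + combination w"
  by (simp add: combination_def type_ring_hom[OF mconst_ring_hom] distrib_right sum.distrib)

lemma combination_scale: "combination (c *s v) = mconst c * combination v"
  by (simp add: combination_def type_ring_hom[OF mconst_ring_hom] sum_distrib_left mult.assoc)

lemma combination_0: "combination 0 = 0"
  by (simp add: combination_def type_ring_hom[OF mconst_ring_hom])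

lemma combination_axis: "combination (axis i 1) = mmonom (t i)"
proof -
  have "combination (axis i 1) = (\<Sum>k\<in>UNIV. if k = i then mmonom (t k) else 0)"
    unfolding combination_def by (intro sum.cong) (auto simp: axis_def type_ring_hom[OF mconst_ring_hom])
  then show ?thesis by simp
qed

text \<open>
  The border relations hold in the module, which gives one inclusion.  Modulo the border relations
  every polynomial is a linear combination of \<open>t\<close>, since multiplying some \<open>t i\<close> by an indeterminate leads to an
  element of \<open>t\<close> or of the border; and \<open>\<pi>\<close> recovers the coefficients of such a combination.
\<close>

lemma point_ideal_eq_I: "point_ideal t b \<Gamma> = I"
proof
  let ?g = "\<lambda>j. mmonom (b j) - (\<Sum>i\<in>UNIV. mconst (\<Gamma> (i, j)) * mmonom (t i)) :: ('n, 'l) mpoly"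
  let ?J = "point_ideal t b \<Gamma>"
  have g: "?g j = mmonom (b j) - combination (\<chi> i. \<Gamma> (i, j))" for j by (simp add: combination_def)
  have "\<pi> (?g j) = 0" for j unfolding g by (simp add: \<pi>_simps(2) \<pi>_b)
  then show JI: "?J \<subseteq> I"
    unfolding point_ideal_def Idl_subset_iff[OF ideal_I] by (auto simp: I_def)
  have J: "ideal ?J ring_of_type_algebra" unfolding point_ideal_def by (rule ideal_Idl)
  note clJ = ideal_closed[OF J]
  have gJ: "?g j \<in> ?J" for j
    using Idl_subset_iff[OF J, of "range ?g"] unfolding point_ideal_def by blast
  \<comment> \<open>\<open>Z\<close> consists of the polynomials that can be reduced to a linear combination of \<open>t\<close>.\<close>
  define Z where "Z = {f. \<exists>v. f - combination v \<in> ?J}"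
  have Z_add: "f + g \<in> Z" if f: "f \<in> Z" and g: "g \<in> Z" for f g
  proof -
    obtain v w where "f - combination v \<in> ?J" "g - combination w \<in> ?J" using f g by (auto simp: Z_def)
    then have "(f - combination v) + (g - combination w) \<in> ?J" by (rule clJ(2))
    then have "f + g - combination (v + w) \<in> ?J" by (simp add: combination_add algebra_simps)
    then show ?thesis by (auto simp: Z_def)
  qed
  have Z_scale: "mconst c * f \<in> Z" if f: "f \<in> Z" for c f
  proof -
    obtain v where "f - combination v \<in> ?J" using f by (auto simp: Z_def)
    then have "mconst c * (f - combination v) \<in> ?J" by (rule clJ(3))
    then have "mconst c * f - combination (c *s v) \<in> ?J" by (simp add: combination_scale right_diff_distrib)
    then show ?thesis by (auto simp: Z_def)
  qed
  have Z_J: "f \<in> Z" if "f \<in> ?J" for f using that by (auto simp: Z_def intro!: exI[of _ 0] simp: combination_0)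
  have Z_combination: "combination v \<in> Z" for v using clJ(1) by (auto simp: Z_def intro!: exI[of _ v])
  have Z_sum: "sum f S \<in> Z" if "\<And>x. x \<in> S \<Longrightarrow> f x \<in> Z" for f and S :: "'m set"
    using that by (induction S rule: infinite_finite_induct) (auto simp: Z_add Z_J clJ(1))
  have Z_next: "mmonom (pvar r + t i) \<in> Z" for r i
  proof (cases "pvar r + t i \<in> range t")
    case True
    then obtain k where "pvar r + t i = t k" by blast
    then show ?thesis using Z_combination[of "axis k 1"] by (simp add: combination_axis)
  next
    case False
    then have "pvar r + t i \<in> border (range t)" by (auto simp: border_def)
    then obtain j where j: "pvar r + t i = b j" using bij_betw_imp_surj_on[OF border] by blast
    have "?g j + combination (\<chi> i. \<Gamma> (i, j)) \<in> Z" by (rule Z_add[OF Z_J[OF gJ] Z_combination])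
    then show ?thesis by (simp add: g j)
  qed
  have Z_mono: "mmonom s \<in> Z" for s
  proof (induction s rule: pterm_induct)
    case zero
    obtain j where "0 = t j" using zero_in_range by blast
    then show ?case using Z_combination[of "axis j 1"] by (simp add: combination_axis)
  next
    case (pvar r s)
    then obtain v where "mmonom s - combination v \<in> ?J" by (auto simp: Z_def)
    then have "mvar r * (mmonom s - combination v) \<in> ?J" by (rule clJ(3))
    moreover have "mvar r * combination v = (\<Sum>i\<in>UNIV. mconst (v $ i) * mmonom (pvar r + t i))"
      by (simp add: combination_def sum_distrib_left mvar_def mmonom_def mconst_def mult_single)
    moreover have "mvar r * mmonom s = (mmonom (pvar r + s) :: ('n, 'l) mpoly)"
      by (simp add: mvar_def mmonom_def mult_single)
    ultimately have "mmonom (pvar r + s) - (\<Sum>i\<in>UNIV. mconst (v $ i) * mmonom (pvar r + t i)) \<in> Z"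
      by (intro Z_J) (simp add: right_diff_distrib)
    from Z_add[OF this Z_sum[of UNIV "\<lambda>i. mconst (v $ i) * mmonom (pvar r + t i)"]]
    show ?case using Z_scale Z_next by simp
  qed
  have "f \<in> Z" for f
  proof (induction f rule: poly_mapping_additive_induct)
    case (single s a)
    have "Poly_Mapping.single s a = mconst a * mmonom s" by (simp add: mconst_def mmonom_def mult_single)
    then show ?case using Z_scale[OF Z_mono] by simp
  qed (rule Z_add)
  show "I \<subseteq> ?J"
  proof
    fix f assume f: "f \<in> I"
    obtain v where v: "f - combination v \<in> ?J" using \<open>f \<in> Z\<close> by (auto simp: Z_def)
    then have "\<pi> (f - combination v) = 0" using JI by (auto simp: I_def)
    then have "v = 0" using f by (simp add: I_def \<pi>_simps)
    then show "f \<in> ?J" using v by (simp add: combination_0)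
  qed
qed

text \<open>
  Specialised at \<open>\<Gamma>\<close>, the matrix becomes the Gram matrix of the linear form with coordinates \<open>z\<close>: the transposes turn
  the product of \<open>t i\<close> and \<open>z\<close> into a pairing of \<open>z\<close> with products of terms.  With \<open>h\<close> one can take \<open>z\<close>
  in the field or as indeterminates over it.
\<close>

lemma map_gorenstein_matrix:
  fixes \<phi> :: "'k::field \<Rightarrow> 'l" and h :: "'l \<Rightarrow> 'c::comm_ring_1"
  assumes \<phi>: "\<phi> \<in> ring_hom ring_of_type_algebra ring_of_type_algebra"
    and h: "h \<in> ring_hom ring_of_type_algebra ring_of_type_algebra"
  shows "map_matrix (meval (\<lambda>f. h (meval \<phi> \<Gamma> f)) z) (gorenstein_matrix t b) =
    (\<chi> k i. \<Sum>q\<in>UNIV. h (E (t i) $ q $ k) * z q)"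
proof -
  let ?\<psi> = "meval \<phi> \<Gamma>"
  note \<psi> = meval_ring_hom[OF \<phi>, of \<Gamma>]
  note h\<psi> = type_ring_hom_comp[OF \<psi> h]
  note simps = type_ring_hom[OF meval_ring_hom[OF h\<psi>]] type_ring_hom[OF h\<psi>]
  have tr: "map_matrix ?\<psi> (transpose N) = transpose (map_matrix ?\<psi> N)"
    for N :: "('m \<times> 'v, 'k) mpoly ^ 'm ^ 'm"
    by (simp add: vec_eq_iff transpose_def)
  have "?\<psi> (pterm_matrix_eval (\<lambda>r. transpose (generic_mult_matrix t b r)) s $ k $ q) = E s $ q $ k" for s k q
  proof -
    have "map_matrix ?\<psi> (pterm_matrix_eval (\<lambda>r. transpose (generic_mult_matrix t b r)) s) = transpose (E s)"
      by (simp add: map_matrix_pterm_matrix_eval[OF \<psi>] tr map_generic_mult_matrix[OF \<phi>] E_transpose)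
    from arg_cong[OF this, of "\<lambda>N. N $ k $ q"] show ?thesis
      by (simp only: nth_map_matrix transpose_def vec_lambda_beta)
  qed
  then show ?thesis
    by (simp add: vec_eq_iff gorenstein_matrix_def matrix_vector_mult_def simps meval_mconst meval_mvar)
qed

lemma locally_gorenstein_iff_det:
  fixes \<phi> :: "'k::field \<Rightarrow> 'l"
  assumes \<phi>: "\<phi> \<in> ring_hom ring_of_type_algebra ring_of_type_algebra"
  shows "locally_gorenstein ring_of_type_algebra (point_ideal t b \<Gamma>) \<longleftrightarrow>
    (\<exists>s. meval \<phi> \<Gamma> (Poly_Mapping.lookup (det (gorenstein_matrix t b)) s) \<noteq> 0)"
proof -
  let ?\<psi> = "meval \<phi> \<Gamma>"
  note \<psi> = meval_ring_hom[OF \<phi>, of \<Gamma>]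
  let ?det = "det (gorenstein_matrix t b) :: ('m, ('m \<times> 'v, 'k) mpoly) mpoly"
  have "locally_gorenstein ring_of_type_algebra (point_ideal t b \<Gamma>) \<longleftrightarrow> cyclic_socles I"
    unfolding point_ideal_eq_I
    using locally_gorenstein_imp_cyclic_socles cyclic_socles_imp_locally_gorenstein by blast
  also have "\<dots> \<longleftrightarrow> (\<exists>s. ?\<psi> (Poly_Mapping.lookup ?det s) \<noteq> 0)"
  proof
    assume "cyclic_socles I"
    then obtain c :: "'l ^ 'm" where c: "det (\<chi> k i. \<Sum>q\<in>UNIV. E (t i) $ q $ k * c $ q) \<noteq> 0"
      using cyclic_socles_imp_nondegenerate by blast
    have id: "(\<lambda>x. x) \<in> ring_hom ring_of_type_algebra (ring_of_type_algebra :: 'l ring)"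
      by (rule type_ring_homI) simp_all
    have "meval ?\<psi> (\<lambda>q. c $ q) ?det \<noteq> 0"
      using c map_gorenstein_matrix[OF \<phi> id, of "\<lambda>q. c $ q"]
      by (simp add: map_matrix_det[OF meval_ring_hom[OF \<psi>]])
    then show "\<exists>s. ?\<psi> (Poly_Mapping.lookup ?det s) \<noteq> 0"
      unfolding meval_def[of ?\<psi>] by (metis (no_types, lifting) mult_zero_left sum.neutral)
  next
    assume ex: "\<exists>s. ?\<psi> (Poly_Mapping.lookup ?det s) \<noteq> 0"
    show "cyclic_socles I"
    proof (rule ccontr)
      assume "\<not> cyclic_socles I"
      then have "meval (\<lambda>f. mconst (?\<psi> f)) mvar ?det = (0 :: ('m, 'l) mpoly)"
        using not_cyclic_socles_imp_det_0
        by (simp add: map_matrix_det[OF meval_ring_hom[OF type_ring_hom_comp[OF \<psi> mconst_ring_hom]]]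
            map_gorenstein_matrix[OF \<phi> mconst_ring_hom])
      then have "?\<psi> (Poly_Mapping.lookup ?det s) = 0" for s
        using lookup_meval_mconst_mvar[OF \<psi>, of ?det s] by simp
      then show False using ex by blast
    qed
  qed
  finally show ?thesis .
qed

end

section \<open>Locally Gorenstein points\<close>

lemma primeideal_kernel:
  fixes \<psi> :: "'a::comm_ring_1 \<Rightarrow> 'l::field"
  assumes \<psi>: "\<psi> \<in> ring_hom ring_of_type_algebra ring_of_type_algebra"
  shows "primeideal {f. \<psi> f = 0} ring_of_type_algebra"
proof (rule primeidealI)
  show "ideal {f. \<psi> f = 0} ring_of_type_algebra"
    by (simp add: ideal_ring_of_type_algebra_iff type_ring_hom[OF \<psi>])
  show "cring (ring_of_type_algebra :: 'a ring)" by (rule cring_from_type_algebra)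
  have "1 \<notin> {f. \<psi> f = 0}" by (simp add: type_ring_hom[OF \<psi>])
  then show "carrier ring_of_type_algebra \<noteq> {f. \<psi> f = 0}" by auto
qed (simp add: type_ring_hom[OF \<psi>])

lemma border_basis_ideal_vanishes_iff:
  fixes t :: "'m::finite \<Rightarrow> 'n::{finite,linorder} pterm" and \<phi> :: "'k::field \<Rightarrow> 'l::field"
  assumes \<phi>: "\<phi> \<in> ring_hom ring_of_type_algebra ring_of_type_algebra"
  shows "border_basis_ideal t b \<subseteq> {f. meval \<phi> \<Gamma> f = 0} \<longleftrightarrow>
    (\<forall>r s. point_mult_matrix t b \<Gamma> r ** point_mult_matrix t b \<Gamma> s =
      point_mult_matrix t b \<Gamma> s ** point_mult_matrix t b \<Gamma> r)"
proof -
  let ?\<psi> = "meval \<phi> \<Gamma>"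
  let ?G = "generic_mult_matrix t b" and ?A = "point_mult_matrix t b \<Gamma>"
  note \<psi> = meval_ring_hom[OF \<phi>, of \<Gamma>]
  have id: "ideal {f. ?\<psi> f = 0} ring_of_type_algebra"
    by (rule primeideal.axioms[OF primeideal_kernel[OF \<psi>]])
  have prod: "?\<psi> ((?G r ** ?G s) $ i $ j) = (?A r ** ?A s) $ i $ j" for r s i j
  proof -
    have "map_matrix ?\<psi> (?G r ** ?G s) = ?A r ** ?A s"
      unfolding map_matrix_mult[OF \<psi>] map_generic_mult_matrix[OF \<phi>] by (rule refl)
    from arg_cong[OF this, of "\<lambda>N. N $ i $ j"] show ?thesis by (simp only: nth_map_matrix)
  qed
  have comm: "?\<psi> ((?G r ** ?G s - ?G s ** ?G r) $ i $ j) = (?A r ** ?A s) $ i $ j - (?A s ** ?A r) $ i $ j" for r s i j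
    by (simp add: type_ring_hom(6)[OF \<psi>] prod)
  have "border_basis_ideal t b \<subseteq> {f. ?\<psi> f = 0} \<longleftrightarrow>
      (\<forall>r s i j. r < s \<longrightarrow> ?\<psi> ((?G r ** ?G s - ?G s ** ?G r) $ i $ j) = 0)"
    unfolding border_basis_ideal_def Idl_subset_iff[OF id] by blast
  also have "\<dots> \<longleftrightarrow> (\<forall>r s. r < s \<longrightarrow> ?A r ** ?A s = ?A s ** ?A r)"
    unfolding comm by (simp add: vec_eq_iff)
  also have "\<dots> \<longleftrightarrow> (\<forall>r s. ?A r ** ?A s = ?A s ** ?A r)"
  proof (intro iffI allI)
    fix r s assume *: "\<forall>r s. r < s \<longrightarrow> ?A r ** ?A s = ?A s ** ?A r"
    show "?A r ** ?A s = ?A s ** ?A r"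
      using *[rule_format, of r s] *[rule_format, of s r] by (cases r s rule: linorder_cases) simp_all
  qed simp
  finally show ?thesis .
qed

lemma rational_points_eq_locally_gorenstein_points:
  fixes t :: "'m::finite \<Rightarrow> 'n::{finite,linorder} pterm"
    and b :: "'v::finite \<Rightarrow> 'n pterm"
    and \<phi> :: "'k::field \<Rightarrow> 'l::field"
  assumes t: "order_ideal (range t)" "inj t" and b: "bij_betw b UNIV (border (range t))"
    and \<phi>: "\<phi> \<in> ring_hom ring_of_type_algebra ring_of_type_algebra"
    and sub: "\<And>J. ideal J ring_of_type_algebra \<Longrightarrow> (nonLGor_ideal t b :: ('m \<times> 'v, 'k) mpoly set) \<subseteq> J \<longleftrightarrow>
      border_basis_ideal t b \<subseteq> J \<and> gorenstein_det_ideal t b \<subseteq> J"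
  shows "rational_points \<phi> (zero_locus (border_basis_ideal t b) - zero_locus (nonLGor_ideal t b)) =
    locally_gorenstein_points t b \<phi>"
proof (rule Set.set_eqI)
  fix \<Gamma> :: "'m \<times> 'v \<Rightarrow> 'l"
  let ?K = "{f. meval \<phi> \<Gamma> f = 0}"
  note \<psi> = meval_ring_hom[OF \<phi>, of \<Gamma>]
  note prime = primeideal_kernel[OF \<psi>]
  have id: "ideal ?K ring_of_type_algebra" by (rule primeideal.axioms[OF prime])
  have "\<Gamma> \<in> rational_points \<phi> (zero_locus (border_basis_ideal t b) - zero_locus (nonLGor_ideal t b)) \<longleftrightarrow>
      border_basis_ideal t b \<subseteq> ?K \<and> \<not> gorenstein_det_ideal t b \<subseteq> ?K"
    using prime sub[OF id] by (auto simp: rational_points_def zero_locus_def)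
  also have "\<dots> \<longleftrightarrow> border_basis_ideal t b \<subseteq> ?K \<and> locally_gorenstein ring_of_type_algebra (point_ideal t b \<Gamma>)"
  proof (rule conj_cong[OF refl])
    assume "border_basis_ideal t b \<subseteq> ?K"
    then interpret border_point t b \<Gamma>
      using t b border_basis_ideal_vanishes_iff[OF \<phi>, of t b \<Gamma>] by unfold_locales auto
    show "\<not> gorenstein_det_ideal t b \<subseteq> ?K \<longleftrightarrow> locally_gorenstein ring_of_type_algebra (point_ideal t b \<Gamma>)"
      unfolding locally_gorenstein_iff_det[OF \<phi>] gorenstein_det_ideal_def Idl_subset_iff[OF id] by auto
  qed
  also have "\<dots> \<longleftrightarrow> \<Gamma> \<in> locally_gorenstein_points t b \<phi>"
    using prime by (auto simp: locally_gorenstein_points_def rational_points_def zero_locus_def)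
  finally show "\<Gamma> \<in> rational_points \<phi> (zero_locus (border_basis_ideal t b) - zero_locus (nonLGor_ideal t b)) \<longleftrightarrow>
    \<Gamma> \<in> locally_gorenstein_points t b \<phi>" .
qed

text \<open>
  Both statements on rational points are instances of the same equality, the first one for the
  identity of \<open>K\<close>.  The rest is that an ideal contains the sum of two ideals iff it contains both.
\<close>

theorem mainTheorem1:
  fixes t :: "'m::{finite,linorder} \<Rightarrow> 'n::{finite,linorder} pterm"
    and b :: "'v::finite \<Rightarrow> 'n pterm"
    and \<phi> :: "'k::field \<Rightarrow> 'l::field"
  assumes "order_ideal (range t)" and "inj t"
    and "\<And>i j. i \<le> j \<Longrightarrow> pterm_deg (t i) \<le> pterm_deg (t j)"
    and "bij_betw b UNIV (border (range t))"
    and "\<phi> \<in> ring_hom ring_of_type_algebra ring_of_type_algebra"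
  shows "ideal (nonLGor_ideal t b :: ('m \<times> 'v, 'k) mpoly set) ring_of_type_algebra
    \<and> (border_basis_ideal t b :: ('m \<times> 'v, 'k) mpoly set) \<subseteq> nonLGor_ideal t b
    \<and> rational_points (id :: 'k \<Rightarrow> 'k)
           (zero_locus (border_basis_ideal t b) - zero_locus (nonLGor_ideal t b))
         = locally_gorenstein_points t b (id :: 'k \<Rightarrow> 'k)
    \<and> rational_points \<phi>
           (zero_locus (border_basis_ideal t b) - zero_locus (nonLGor_ideal t b))
         = locally_gorenstein_points t b \<phi>"
proof -
  let ?R = "ring_of_type_algebra :: ('m \<times> 'v, 'k) mpoly ring"
  let ?I = "border_basis_ideal t b :: ('m \<times> 'v, 'k) mpoly set"
  let ?J = "gorenstein_det_ideal t b :: ('m \<times> 'v, 'k) mpoly set"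
  let ?N = "nonLGor_ideal t b :: ('m \<times> 'v, 'k) mpoly set"
  interpret cring ?R by (rule cring_from_type_algebra)
  have I: "ideal ?I ?R" unfolding border_basis_ideal_def by (rule ideal_Idl)
  have J: "ideal ?J ?R" unfolding gorenstein_det_ideal_def by (rule ideal_Idl)
  have N: "ideal ?N ?R" unfolding nonLGor_ideal_def by (rule add_ideals[OF I J])
  have mem: "f \<in> ?N \<longleftrightarrow> (\<exists>g\<in>?I. \<exists>h\<in>?J. f = g + h)" for f
    by (auto simp: nonLGor_ideal_def set_add_def')
  have IN: "?I \<subseteq> ?N" and JN: "?J \<subseteq> ?N"
  proof -
    have "f + 0 \<in> ?N" if "f \<in> ?I" for f using mem ideal_closed(1)[OF J] that by blast
    then show "?I \<subseteq> ?N" by auto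
    have "0 + f \<in> ?N" if "f \<in> ?J" for f using mem ideal_closed(1)[OF I] that by blast
    then show "?J \<subseteq> ?N" by auto
  qed
  have sub: "?N \<subseteq> K \<longleftrightarrow> ?I \<subseteq> K \<and> ?J \<subseteq> K" if K: "ideal K ?R" for K
  proof
    assume IJ: "?I \<subseteq> K \<and> ?J \<subseteq> K"
    show "?N \<subseteq> K"
    proof
      fix f assume "f \<in> ?N"
      then obtain g h where gh: "g \<in> ?I" "h \<in> ?J" "f = g + h" using mem by blast
      then have "g \<in> K" "h \<in> K" using IJ by blast+
      then show "f \<in> K" unfolding gh(3) by (rule ideal_closed(2)[OF K])
    qed
  qed (use IN JN in blast)
  have id: "(id :: 'k \<Rightarrow> 'k) \<in> ring_hom ring_of_type_algebra ring_of_type_algebra"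
    by (rule type_ring_homI) simp_all
  show ?thesis
    using N IN rational_points_eq_locally_gorenstein_points[OF assms(1,2,4) id sub]
      rational_points_eq_locally_gorenstein_points[OF assms(1,2,4,5) sub] by blast
qed

end
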